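(* Let $\mathbf{d}$ be a hemimetric on a set $X$. The following are equivalent. (1) $X$ is $\mathbf{d}$-Noetherian. (2) $(\mathcal{P}_0^{\mathbf{d}}(X),\mathbf{d}_{+\mathcal{H}})$ is Smyth complete. (3) $(\mathcal{P}_0^{\mathbf{d}}(X),\mathbf{d}_+^{\mathcal{H}})$ is a hemimetric space. (4) $(X,\mathbf{d})$ has a hemimetric Smyth completion.
   Context: Suprema and infima are taken in $[0,\infty]$, with $\sup\emptyset=0$, $\inf\emptyset=\infty$; for $a,b\in[0,\infty]$, $(a-b)_+=\min\{c\in[0,\infty]:a\leq b+c\}$; for real $r$, $r_+=\max(r,0)$, and $\infty_+=\infty$. A distance on $X$ is a function $\mathbf{d}:X\times X\to[0,\infty]$, written $x\mathbf{d}y$, with $x\mathbf{d}z\leq x\mathbf{d}y+y\mathbf{d}z$ for all $x,y,z$; it is a hemimetric if moreover $x\mathbf{d}x=0$ for all $x$ (no symmetry is required). $x\mathbf{d}^{\mathrm{op}}y=y\mathbf{d}x$. The upper and lower hemimetrics are $x\overline{\mathbf{d}}z=\sup_{y\in X}(x\mathbf{d}y-z\mathbf{d}y)_+$ and $z\underline{\mathbf{d}}y=\sup_{x\in X}(x\mathbf{d}y-x\mathbf{d}z)_+$. A net is a family $(x_\lambda)_{\lambda\in\Lambda}$ indexed by a non-empty set with a transitive (not necessarily reflexive) relation $\prec$ such that any two elements $\gamma,\delta$ have some $\lambda$ with $\gamma,\delta\prec\lambda$; limits are taken along $\prec$; sequences are nets indexed by $(\mathbb{N},<)$. A net is $\mathbf{d}$-Cauchy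 if $\lim_\gamma\sup_{\gamma\prec\delta}x_\gamma\mathbf{d}x_\delta=0$. $X$ is $\mathbf{d}$-Noetherian if every $\mathbf{d}$-Cauchy sequence in $X$ is $\mathbf{d}^{\mathrm{op}}$-Cauchy. The Smyth topology $\mathbf{d}^\bullet_\circ$ is generated by the sets $\{x:c\mathbf{d}x<r\}$ and $\{x:c\mathbf{d}x>r\}$ ($c\in X$, $r$ real). $(X,\mathbf{d})$ is Smyth complete ($\mathbf{d}^\bullet_\circ$-complete) if every $\mathbf{d}$-Cauchy net in $X$ has a $\mathbf{d}^\bullet_\circ$-limit in $X$. $B\subseteq X$ is a $\mathbf{d}^\bullet_\circ$-basis of $X$ if every $x\in X$ is a $\mathbf{d}^\bullet_\circ$-limit of some $\mathbf{d}$-Cauchy net in $B$. $X$ is a $\mathbf{d}^\bullet_\circ$-domain if it is $\mathbf{d}^\bullet_\circ$-complete, $X$ is a $\mathbf{d}^\bullet_\circ$-basis of itself, and $\overline{\mathbf{d}}\leq\underline{\mathbf{d}}$ pointwise. A Smyth completion of $(X,\mathbf{d})$ is a set $X'\supseteq X$ with a distance $\mathbf{d}'$ on $X'$ such that $\mathbf{d}'|_X=\mathbf{d}$, $X'$ is a $\mathbf{d}'{}^\bullet_\circ$-domain and $X$ is a $\mathbf{d}'{}^\bullet_\circ$-basis of $X'$; it is a hemimetric Smyth completion if $\mathbf{d}'$ is a hemimetric. Formal balls: $X_+=X\times[0,\infty)$ with the distance $(x,r)\mathbf{d}_+(y,s)=(x\mathbf{d}y-r+s)_+$. On subsets of $X_+$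 define $Y\mathbf{d}_+^{\mathcal{H}}Z=\inf_{z\in Z}\sup_{y\in Y}y\mathbf{d}_+z$ and $Y\mathbf{d}_{+\mathcal{H}}Z=\sup_{y\in Y}\inf_{z\in Z}y\mathbf{d}_+z$; both are distances on $\mathcal{P}(X_+)$. $Y\subseteq X_+$ is $\mathbf{d}_+$-directed if $\inf_{y\in Y}\sup_{z\in F}z\mathbf{d}_+y=0$ for every finite $F\subseteq Y$ (so $Y\neq\emptyset$). $\mathcal{P}_0^{\mathbf{d}}(X)$ is the set of $\mathbf{d}_+$-directed $Y\subseteq X_+$ with $\inf_{(x,r)\in Y}r=0$. *)

theory Defs
  imports "HOL-Analysis.Analysis"
begin

text \<open>
  Distances take values in \<^typ>\<open>ennreal\<close> and are considered on a carrier set; their values outside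
  the carrier are irrelevant.
\<close>

definition distance_on :: "'a set \<Rightarrow> ('a \<Rightarrow> 'a \<Rightarrow> ennreal) \<Rightarrow> bool" where
  "distance_on X d \<longleftrightarrow> (\<forall>x\<in>X. \<forall>y\<in>X. \<forall>z\<in>X. d x z \<le> d x y + d y z)"

definition hemimetric_on :: "'a set \<Rightarrow> ('a \<Rightarrow> 'a \<Rightarrow> ennreal) \<Rightarrow> bool" where
  "hemimetric_on X d \<longleftrightarrow> distance_on X d \<and> (\<forall>x\<in>X. d x x = 0)"

definition op_dist :: "('a \<Rightarrow> 'a \<Rightarrow> ennreal) \<Rightarrow> 'a \<Rightarrow> 'a \<Rightarrow> ennreal" where
  "op_dist d x y = d y x"

text \<open>
  The difference on \<^typ>\<open>ennreal\<close> in the library has \<open>\<infinity> - \<infinity> = \<infinity>\<close>, whereas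
  the upper and lower hemimetrics need \<open>(\<infinity> - \<infinity>)\<^sub>+ = 0\<close>.
\<close>

definition pos_diff :: "ennreal \<Rightarrow> ennreal \<Rightarrow> ennreal" where
  "pos_diff a b = Inf {c. a \<le> b + c}"

definition upper_hemi :: "'a set \<Rightarrow> ('a \<Rightarrow> 'a \<Rightarrow> ennreal) \<Rightarrow> 'a \<Rightarrow> 'a \<Rightarrow> ennreal" where
  "upper_hemi X d x z = (SUP y\<in>X. pos_diff (d x y) (d z y))"

definition lower_hemi :: "'a set \<Rightarrow> ('a \<Rightarrow> 'a \<Rightarrow> ennreal) \<Rightarrow> 'a \<Rightarrow> 'a \<Rightarrow> ennreal" where
  "lower_hemi X d z y = (SUP x\<in>X. pos_diff (d x y) (d x z))"

text \<open>The relation of a net need not be reflexive.\<close>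

definition net_index :: "'i set \<Rightarrow> ('i \<Rightarrow> 'i \<Rightarrow> bool) \<Rightarrow> bool" where
  "net_index I R \<longleftrightarrow> I \<noteq> {} \<and> transp_on I R \<and> (\<forall>i\<in>I. \<forall>j\<in>I. \<exists>k\<in>I. R i k \<and> R j k)"

definition net_filter :: "'i set \<Rightarrow> ('i \<Rightarrow> 'i \<Rightarrow> bool) \<Rightarrow> 'i filter" where
  "net_filter I R = (INF i\<in>I. principal {j\<in>I. R i j})"

definition cauchy_net ::
  "('a \<Rightarrow> 'a \<Rightarrow> ennreal) \<Rightarrow> 'i set \<Rightarrow> ('i \<Rightarrow> 'i \<Rightarrow> bool) \<Rightarrow> ('i \<Rightarrow> 'a) \<Rightarrow> bool" where
  "cauchy_net d I R x \<longleftrightarrow>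
     ((\<lambda>i. SUP j\<in>{j\<in>I. R i j}. d (x i) (x j)) \<longlongrightarrow> 0) (net_filter I R)"

definition noetherian :: "'a set \<Rightarrow> ('a \<Rightarrow> 'a \<Rightarrow> ennreal) \<Rightarrow> bool" where
  "noetherian X d \<longleftrightarrow>
     (\<forall>x :: nat \<Rightarrow> 'a. range x \<subseteq> X \<and> cauchy_net d UNIV (<) x \<longrightarrow> cauchy_net (op_dist d) UNIV (<) x)"

text \<open>
  Negative \<open>r\<close> is allowed, so for non-empty \<open>X\<close> the topological space is all of \<open>X\<close>.
\<close>

definition smyth_topology :: "'a set \<Rightarrow> ('a \<Rightarrow> 'a \<Rightarrow> ennreal) \<Rightarrow> 'a topology" where
  "smyth_topology X d = topology_generated_by
     ({{x\<in>X. enn2ereal (d c x) < ereal r} |c r. c \<in> X} \<union>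
      {{x\<in>X. enn2ereal (d c x) > ereal r} |c r. c \<in> X})"

definition smyth_limit ::
  "'a set \<Rightarrow> ('a \<Rightarrow> 'a \<Rightarrow> ennreal) \<Rightarrow> 'i set \<Rightarrow> ('i \<Rightarrow> 'i \<Rightarrow> bool) \<Rightarrow> ('i \<Rightarrow> 'a) \<Rightarrow> 'a \<Rightarrow> bool" where
  "smyth_limit X d I R x l \<longleftrightarrow> limitin (smyth_topology X d) x l (net_filter I R)"

text \<open>
  Nets have arbitrary index sets, but a definition cannot quantify over types. In the next two
  definitions the index sets are the subsets of \<^typ>\<open>'a \<times> real\<close>, where \<^typ>\<open>'a\<close> is the type of the
  points. This is no restriction: by the lemmas \<open>smyth_complete_any_index\<close> and
  \<open>smyth_basis_any_index\<close> below, both notions are the same as with nets over any index type.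
\<close>

definition smyth_complete :: "'a set \<Rightarrow> ('a \<Rightarrow> 'a \<Rightarrow> ennreal) \<Rightarrow> bool" where
  "smyth_complete X d \<longleftrightarrow>
     (\<forall>(I :: ('a \<times> real) set) R x. net_index I R \<and> x ` I \<subseteq> X \<and> cauchy_net d I R x \<longrightarrow>
        (\<exists>l\<in>X. smyth_limit X d I R x l))"

definition smyth_basis :: "'a set \<Rightarrow> 'a set \<Rightarrow> ('a \<Rightarrow> 'a \<Rightarrow> ennreal) \<Rightarrow> bool" where
  "smyth_basis B X d \<longleftrightarrow> B \<subseteq> X \<and>
     (\<forall>l\<in>X. \<exists>(I :: ('a \<times> real) set) R x. net_index I R \<and> x ` I \<subseteq> B \<and> cauchy_net d I R x \<and>
        smyth_limit X d I R x l)"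

definition smyth_domain :: "'a set \<Rightarrow> ('a \<Rightarrow> 'a \<Rightarrow> ennreal) \<Rightarrow> bool" where
  "smyth_domain X d \<longleftrightarrow> smyth_complete X d \<and> smyth_basis X X d \<and>
     (\<forall>x\<in>X. \<forall>y\<in>X. upper_hemi X d x y \<le> lower_hemi X d x y)"

text \<open>The inclusion of \<open>X\<close> in its completion is rendered by an injection \<open>e\<close>.\<close>

definition smyth_completion ::
  "'a set \<Rightarrow> ('a \<Rightarrow> 'a \<Rightarrow> ennreal) \<Rightarrow> ('a \<Rightarrow> 'b) \<Rightarrow> 'b set \<Rightarrow> ('b \<Rightarrow> 'b \<Rightarrow> ennreal) \<Rightarrow> bool" where
  "smyth_completion X d e X' d' \<longleftrightarrow>
     inj_on e X \<and> e ` X \<subseteq> X' \<and> distance_on X' d' \<and>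
     (\<forall>x\<in>X. \<forall>y\<in>X. d' (e x) (e y) = d x y) \<and>
     smyth_domain X' d' \<and> smyth_basis (e ` X) X' d'"

definition hemimetric_smyth_completion ::
  "'a set \<Rightarrow> ('a \<Rightarrow> 'a \<Rightarrow> ennreal) \<Rightarrow> ('a \<Rightarrow> 'b) \<Rightarrow> 'b set \<Rightarrow> ('b \<Rightarrow> 'b \<Rightarrow> ennreal) \<Rightarrow> bool" where
  "hemimetric_smyth_completion X d e X' d' \<longleftrightarrow> smyth_completion X d e X' d' \<and> hemimetric_on X' d'"

definition formal_balls :: "'a set \<Rightarrow> ('a \<times> real) set" where
  "formal_balls X = X \<times> {0..}"

text \<open>
  The subtraction below is the truncated one of \<^typ>\<open>ennreal\<close> with a finite subtrahend, so for
  \<open>r, s \<ge> 0\<close> it yields the positive part of \<open>d x y - r + s\<close>, and \<open>\<infinity>\<close> if \<open>d x y = \<infinity>\<close>.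
\<close>

definition ball_dist ::
  "('a \<Rightarrow> 'a \<Rightarrow> ennreal) \<Rightarrow> 'a \<times> real \<Rightarrow> 'a \<times> real \<Rightarrow> ennreal" where
  "ball_dist d = (\<lambda>(x, r) (y, s). (d x y + ennreal s) - ennreal r)"

definition upper_ball_dist ::
  "('a \<Rightarrow> 'a \<Rightarrow> ennreal) \<Rightarrow> ('a \<times> real) set \<Rightarrow> ('a \<times> real) set \<Rightarrow> ennreal" where
  "upper_ball_dist d Y Z = (INF z\<in>Z. SUP y\<in>Y. ball_dist d y z)"

definition lower_ball_dist ::
  "('a \<Rightarrow> 'a \<Rightarrow> ennreal) \<Rightarrow> ('a \<times> real) set \<Rightarrow> ('a \<times> real) set \<Rightarrow> ennreal" where
  "lower_ball_dist d Y Z = (SUP y\<in>Y. INF z\<in>Z. ball_dist d y z)"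

definition ball_directed :: "('a \<Rightarrow> 'a \<Rightarrow> ennreal) \<Rightarrow> ('a \<times> real) set \<Rightarrow> bool" where
  "ball_directed d Y \<longleftrightarrow> (\<forall>F. finite F \<and> F \<subseteq> Y \<longrightarrow> (INF y\<in>Y. SUP z\<in>F. ball_dist d z y) = 0)"

definition P0 :: "'a set \<Rightarrow> ('a \<Rightarrow> 'a \<Rightarrow> ennreal) \<Rightarrow> ('a \<times> real) set set" where
  "P0 X d = {Y. Y \<subseteq> formal_balls X \<and> ball_directed d Y \<and> (INF (x, r)\<in>Y. ennreal r) = 0}"


subsection \<open>Independence of the index type\<close>

lemma eventually_net_filter:
  assumes "net_index I R"
  shows "eventually P (net_filter I R) \<longleftrightarrow> (\<exists>i\<in>I. \<forall>j\<in>I. R i j \<longrightarrow> P j)"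
proof -
  have "eventually P (net_filter I R) \<longleftrightarrow> (\<exists>i\<in>I. eventually P (principal {j\<in>I. R i j}))"
    unfolding net_filter_def
  proof (rule eventually_INF_base)
    show "I \<noteq> {}" using assms by (simp add: net_index_def)
    fix a b assume ab: "a \<in> I" "b \<in> I"
    then obtain k where k: "k \<in> I" "R a k" "R b k"
      using assms by (auto simp: net_index_def)
    have t: "R i l" if "R i k" "R k l" "i \<in> I" "l \<in> I" for i l
      using assms that k(1) unfolding net_index_def by (meson transp_onD)
    show "\<exists>x\<in>I. principal {j\<in>I. R x j} \<le> inf (principal {j\<in>I. R a j}) (principal {j\<in>I. R b j})"
    proof (intro bexI[of _ k] le_infI)
      show "k \<in> I" by fact
    qed (use t[OF k(2)] t[OF k(3)] ab in auto)
  qed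
  then show ?thesis by (simp add: eventually_principal Ball_def imp_conjL)
qed

lemma smyth_limit_iff:
  fixes x :: "'i \<Rightarrow> 'a"
  assumes x: "x ` I \<subseteq> X" and N: "net_index I R"
  shows "smyth_limit X d I R x l \<longleftrightarrow>
           l \<in> X \<and> (\<forall>c\<in>X. ((\<lambda>i. d c (x i)) \<longlongrightarrow> d c l) (net_filter I R))"
proof -
  let ?F = "net_filter I R"
  let ?S = "{{x\<in>X. enn2ereal (d c x) < ereal r} |c r. c \<in> X} \<union>
            {{x\<in>X. enn2ereal (d c x) > ereal r} |c r. c \<in> X}"
  have xX: "eventually (\<lambda>i. x i \<in> X) ?F"
    unfolding eventually_net_filter[OF N] using x N by (auto simp: net_index_def image_subset_iff)
  have neg: "enn2ereal a > ereal (-1)" for a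
  proof -
    have "ereal (-1) < 0" by simp
    then show ?thesis using enn2ereal_nonneg[of a] less_le_trans by blast
  qed
  have top: "topspace (smyth_topology X d) = X"
  proof
    show "topspace (smyth_topology X d) \<subseteq> X"
      unfolding smyth_topology_def topology_generated_by_topspace by auto
    show "X \<subseteq> topspace (smyth_topology X d)"
    proof
      fix z assume z: "z \<in> X"
      have "{x\<in>X. enn2ereal (d z x) > ereal (-1)} \<in> ?S" using z by blast
      moreover have "z \<in> {x\<in>X. enn2ereal (d z x) > ereal (-1)}" using z neg by simp
      ultimately show "z \<in> topspace (smyth_topology X d)"
        unfolding smyth_topology_def topology_generated_by_topspace by blast
    qed
  qed
  have lim: "smyth_limit X d I R x l \<longleftrightarrow>
    l \<in> X \<and> (\<forall>U\<in>?S. l \<in> U \<longrightarrow> eventually (\<lambda>i. x i \<in> U) ?F)" (is "_ \<longleftrightarrow> ?rhs")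
  proof
    assume "smyth_limit X d I R x l"
    then have "l \<in> X" and ev: "\<And>U. openin (smyth_topology X d) U \<Longrightarrow> l \<in> U \<Longrightarrow> eventually (\<lambda>i. x i \<in> U) ?F"
      unfolding smyth_limit_def limitin_def top by simp_all
    then show ?rhs
    proof (intro conjI ballI impI)
      fix U assume U: "U \<in> ?S" "l \<in> U"
      have "openin (smyth_topology X d) U"
        unfolding smyth_topology_def using U(1) by (rule topology_generated_by_Basis)
      then show "eventually (\<lambda>i. x i \<in> U) ?F" using U(2) by (rule ev)
    qed
  next
    assume r: ?rhs
    have "generate_topology_on ?S U \<Longrightarrow> l \<in> U \<longrightarrow> eventually (\<lambda>i. x i \<in> U) ?F" for U
    proof (induction U rule: generate_topology_on.induct)
      case (Int a b) then show ?case by (auto intro: eventually_conj)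
    next
      case (UN K)
      show ?case
      proof
        assume "l \<in> \<Union>K"
        then obtain k where "k \<in> K" "l \<in> k" by blast
        with UN have "eventually (\<lambda>i. x i \<in> k) ?F" by blast
        then show "eventually (\<lambda>i. x i \<in> \<Union>K) ?F"
          by (rule eventually_mono) (use \<open>k \<in> K\<close> in blast)
      qed
    next
      case (Basis s)
      then show ?case by (rule r[THEN conjunct2, THEN bspec])
    qed simp
    then show "smyth_limit X d I R x l"
      using r[THEN conjunct1] unfolding smyth_limit_def limitin_def top
      unfolding smyth_topology_def openin_topology_generated_by_iff by simp
  qed
  have "(\<forall>U\<in>?S. l \<in> U \<longrightarrow> eventually (\<lambda>i. x i \<in> U) ?F) \<longleftrightarrow>
     (\<forall>c\<in>X. ((\<lambda>i. d c (x i)) \<longlongrightarrow> d c l) ?F)" (is "?L \<longleftrightarrow> ?R") if l: "l \<in> X"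
  proof
    assume L: ?L
    show ?R
    proof (intro ballI order_tendstoI)
      fix c a assume c: "c \<in> X" and a: "a < d c l"
      then have "enn2ereal a < enn2ereal (d c l)" by (simp add: less_ennreal.rep_eq)
      then obtain r where r: "enn2ereal a < ereal r" "ereal r < enn2ereal (d c l)"
        using ereal_dense2 by blast
      have "{x\<in>X. enn2ereal (d c x) > ereal r} \<in> ?S" using c by blast
      from L[THEN bspec, OF this] r l
      have "eventually (\<lambda>i. x i \<in> {x\<in>X. enn2ereal (d c x) > ereal r}) ?F" by simp
      then show "eventually (\<lambda>i. a < d c (x i)) ?F"
        by (rule eventually_mono) (use r in \<open>auto simp: less_ennreal.rep_eq\<close>)
    next
      fix c a assume c: "c \<in> X" and a: "d c l < a"
      then have "enn2ereal (d c l) < enn2ereal a" by (simp add: less_ennreal.rep_eq)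
      then obtain r where r: "enn2ereal (d c l) < ereal r" "ereal r < enn2ereal a"
        using ereal_dense2 by blast
      have "{x\<in>X. enn2ereal (d c x) < ereal r} \<in> ?S" using c by blast
      from L[THEN bspec, OF this] r l
      have "eventually (\<lambda>i. x i \<in> {x\<in>X. enn2ereal (d c x) < ereal r}) ?F" by simp
      then show "eventually (\<lambda>i. d c (x i) < a) ?F"
        by (rule eventually_mono) (use r in \<open>auto simp: less_ennreal.rep_eq\<close>)
    qed
  next
    assume R: ?R
    have T: "((\<lambda>i. enn2ereal (d c (x i))) \<longlongrightarrow> enn2ereal (d c l)) ?F" if "c \<in> X" for c
      using R that by (intro continuous_on_tendsto_compose[OF continuous_on_enn2ereal]) auto
    show ?L
    proof (intro ballI impI)
      fix U assume "U \<in> ?S" "l \<in> U"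
      then consider c r where "c \<in> X" "U = {x\<in>X. enn2ereal (d c x) < ereal r}" "enn2ereal (d c l) < ereal r"
        | c r where "c \<in> X" "U = {x\<in>X. enn2ereal (d c x) > ereal r}" "enn2ereal (d c l) > ereal r"
        by blast
      then show "eventually (\<lambda>i. x i \<in> U) ?F"
      proof cases
        case 1
        then show ?thesis using order_tendstoD(2)[OF T[of c], of "ereal r"] xX
          by (auto elim: eventually_elim2)
      next
        case 2
        then show ?thesis using order_tendstoD(1)[OF T[of c], of "ereal r"] xX
          by (auto elim: eventually_elim2)
      qed
    qed
  qed
  then show ?thesis unfolding lim by (rule conj_cong[OF refl])
qed

lemma cauchy_net_reindex:
  fixes x :: "'i \<Rightarrow> 'a"
  assumes d: "distance_on X d" and N: "net_index I R" and x: "x ` I \<subseteq> X"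
    and C: "cauchy_net d I R x"
  obtains J :: "('a \<times> real) set" and S y where
    "net_index J S" "y ` J \<subseteq> x ` I" "cauchy_net d J S y"
    "\<And>l. smyth_limit X d J S y l \<longleftrightarrow> smyth_limit X d I R x l"
proof -
  define w where "w i = (SUP j\<in>{j\<in>I. R i j}. d (x i) (x j))" for i
  define J where "J = {(x i, t) |i t. i \<in> I \<and> w i < ennreal t}"
  define S where "S p q \<longleftrightarrow> d (fst p) (fst q) + ennreal (snd q) < ennreal (snd p)"
    for p q :: "'a \<times> real"
  have tri: "d a c \<le> d a b + d b c" if "a \<in> X" "b \<in> X" "c \<in> X" for a b c
    using d that by (auto simp: distance_on_def)
  have xX: "x i \<in> X" if "i \<in> I" for i using x that by auto
  have JX: "fst p \<in> X" if "p \<in> J" for p using that xX by (auto simp: J_def)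
  have Rtr: "R i k" if "R i j" "R j k" "i \<in> I" "j \<in> I" "k \<in> I" for i j k
    using N that unfolding net_index_def transp_on_def by blast
  have wle: "d (x i) (x j) \<le> w i" if "i \<in> I" "j \<in> I" "R i j" for i j
    unfolding w_def by (rule SUP_upper) (use that in auto)
  have wlim: "(w \<longlongrightarrow> 0) (net_filter I R)"
    using C by (simp add: cauchy_net_def w_def[abs_def])
  have small: "\<exists>i\<in>I. \<forall>j\<in>I. R i j \<longrightarrow> w j < e" if "e > 0" for e
    using order_tendstoD(2)[OF wlim that] by (simp add: eventually_net_filter[OF N])
  have up2: "\<exists>k\<in>I. R i k \<and> R j k" if "i \<in> I" "j \<in> I" for i j
    using N that by (auto simp: net_index_def)
  have small2: "\<exists>k\<in>I. R i k \<and> R j k \<and> w k < e" if "e > 0" "i \<in> I" "j \<in> I" for e i j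
  proof -
    obtain k where k: "k \<in> I" "\<And>l. l \<in> I \<Longrightarrow> R k l \<Longrightarrow> w l < e" using small \<open>e > 0\<close> by blast
    obtain m where m: "m \<in> I" "R i m" "R j m" using up2[OF \<open>i \<in> I\<close> \<open>j \<in> I\<close>] by blast
    obtain n where n: "n \<in> I" "R k n" "R m n" using up2 k m by blast
    have "R i n" by (rule Rtr[OF m(2) n(3) \<open>i \<in> I\<close> m(1) n(1)])
    moreover have "R j n" by (rule Rtr[OF m(3) n(3) \<open>j \<in> I\<close> m(1) n(1)])
    ultimately show ?thesis using k(2)[OF n(1,2)] n(1) by blast
  qed
  have gap: "\<exists>e>0. \<forall>u v. u \<le> w i \<longrightarrow> v \<le> ennreal e \<longrightarrow> u + v < ennreal t" if "w i < ennreal t" for i t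
  proof -
    obtain r where r: "w i = ennreal r" "r \<ge> 0"
      using \<open>w i < ennreal t\<close> by (cases "w i") auto
    have rt: "r < t" using \<open>w i < ennreal t\<close> r by (simp add: ennreal_less_iff)
    have "u + v < ennreal t" if "u \<le> w i" "v \<le> ennreal ((t - r) / 2)" for u v
    proof -
      have "u + v \<le> ennreal r + ennreal ((t - r) / 2)"
        using add_mono[OF that] r by simp
      also have "\<dots> = ennreal (r + (t - r) / 2)" using r rt by (simp add: ennreal_plus[symmetric] del: ennreal_plus)
      also have "\<dots> < ennreal t" using r rt by (subst ennreal_less_iff) (auto simp: field_simps)
      finally show ?thesis .
    qed
    then show ?thesis using rt by (intro exI[of _ "(t - r) / 2"]) auto
  qed
  have step: "S (x i, t) (x k, s)" if "i \<in> I" "k \<in> I" "R i k" "s \<le> e"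
    "\<forall>u v. u \<le> w i \<longrightarrow> v \<le> ennreal e \<longrightarrow> u + v < ennreal t" for i k t s e
    unfolding S_def using that wle[of i k] by (auto intro: ennreal_leI)
  have NJ: "net_index J S"
    unfolding net_index_def
  proof (intro conjI ballI)
    obtain i0 where "i0 \<in> I" using N unfolding net_index_def by blast
    then obtain i where i: "i \<in> I" "w i < 1"
      using small2[OF zero_less_one, of i0 i0] by blast
    then have "(x i, 1) \<in> J" by (auto simp: J_def)
    then show "J \<noteq> {}" by blast
    show "transp_on J S"
    proof (rule transp_onI)
      fix p q r assume pqr: "p \<in> J" "q \<in> J" "r \<in> J" and "S p q" "S q r"
      have "d (fst p) (fst r) + ennreal (snd r)
          \<le> d (fst p) (fst q) + (d (fst q) (fst r) + ennreal (snd r))"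
        using add_right_mono[OF tri[OF JX JX JX, OF pqr], of "ennreal (snd r)"]
        by (simp only: add.assoc)
      also have "\<dots> \<le> d (fst p) (fst q) + ennreal (snd q)"
        using \<open>S q r\<close> by (intro add_left_mono) (simp add: S_def)
      also have "\<dots> < ennreal (snd p)" using \<open>S p q\<close> by (simp add: S_def)
      finally show "S p r" by (simp add: S_def)
    qed
    fix p q assume "p \<in> J" "q \<in> J"
    then obtain i s j t where i: "i \<in> I" "w i < ennreal s" "p = (x i, s)"
      and j: "j \<in> I" "w j < ennreal t" "q = (x j, t)" by (auto simp: J_def)
    obtain e where e: "e > 0" "\<forall>u v. u \<le> w i \<longrightarrow> v \<le> ennreal e \<longrightarrow> u + v < ennreal s"
      using gap[OF i(2)] by blast
    obtain f where f: "f > 0" "\<forall>u v. u \<le> w j \<longrightarrow> v \<le> ennreal f \<longrightarrow> u + v < ennreal t"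
      using gap[OF j(2)] by blast
    obtain k where k: "k \<in> I" "R i k" "R j k" "w k < ennreal (min e f)"
      using small2[of "ennreal (min e f)" i j] e f i j by auto
    show "\<exists>k\<in>J. S p k \<and> S q k"
    proof (intro bexI conjI)
      show "(x k, min e f) \<in> J" using k by (auto simp: J_def)
      show "S p (x k, min e f)" unfolding i by (rule step[OF i(1) k(1,2) _ e(2)]) simp
      show "S q (x k, min e f)" unfolding j by (rule step[OF j(1) k(1,3) _ f(2)]) simp
    qed
  qed
  have rad: "snd q < snd p" "d (fst p) (fst q) < ennreal (snd p)"
    if "p \<in> J" "q \<in> J" "S p q" for p q
  proof -
    have q: "snd q > 0"
    proof -
      obtain i where "w i < ennreal (snd q)" using \<open>q \<in> J\<close> by (auto simp: J_def)
      then have "0 < ennreal (snd q)" by (rule le_less_trans[OF zero_le])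
      then show ?thesis by simp
    qed
    have "ennreal (snd q) \<le> d (fst p) (fst q) + ennreal (snd q)"
      "d (fst p) (fst q) \<le> d (fst p) (fst q) + ennreal (snd q)" by (simp_all)
    with that(3) have "ennreal (snd q) < ennreal (snd p)" "d (fst p) (fst q) < ennreal (snd p)"
      unfolding S_def by (blast intro: le_less_trans)+
    then show "snd q < snd p" "d (fst p) (fst q) < ennreal (snd p)"
      using q by (auto simp: ennreal_less_iff)
  qed
  have tail: "\<exists>i\<in>I. w i < e \<and> P i \<and> (\<exists>t. 0 < t \<and> ennreal t \<le> e \<and> (x i, t) \<in> J)"
    if e: "e > 0" and P: "eventually P (net_filter I R)" for e P
  proof -
    obtain i where i: "i \<in> I" "\<And>j. j \<in> I \<Longrightarrow> R i j \<Longrightarrow> P j"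
      using P unfolding eventually_net_filter[OF N] by blast
    define e' where "e' = min e 1"
    have "e' < top" unfolding e'_def by (simp add: min_less_iff_disj)
    then obtain r where r: "e' = ennreal r" "r \<ge> 0" by (cases e') auto
    have e': "e' > 0" "e' \<le> e" using e by (auto simp: e'_def)
    obtain k where k: "k \<in> I" "R i k" "w k < e'" using small2[OF e'(1) i(1) i(1)] by blast
    have "(x k, r) \<in> J" using k r by (auto simp: J_def)
    moreover have "0 < r" using e' r by simp
    moreover have "w k < e" using k(3) e'(2) by (rule less_le_trans)
    moreover have "P k" using i(2)[OF k(1,2)] .
    moreover have "ennreal r \<le> e" using e'(2) r(1) by simp
    ultimately show ?thesis using k(1) by blast
  qed
  have radsmall: "eventually (\<lambda>p. ennreal (snd p) < e) (net_filter J S)" if "e > 0" for e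
  proof -
    obtain i t where t: "t > 0" "ennreal t \<le> e" "(x i, t) \<in> J"
      using tail[OF \<open>e > 0\<close>, of "\<lambda>_. True"] by auto
    have "ennreal (snd q) < e" if "q \<in> J" "S (x i, t) q" for q
    proof -
      have "snd q < t" using rad(1)[OF t(3) that] by simp
      then have "ennreal (snd q) < ennreal t" using t(1) by (simp add: ennreal_lessI)
      then show ?thesis using t(2) by (rule less_le_trans)
    qed
    then show ?thesis using t(3) unfolding eventually_net_filter[OF NJ] by blast
  qed
  have CJ: "cauchy_net d J S fst"
    unfolding cauchy_net_def
  proof (rule order_tendstoI)
    fix e :: ennreal assume e: "0 < e"
    have "eventually (\<lambda>p. p \<in> J) (net_filter J S)"
      using NJ unfolding eventually_net_filter[OF NJ] net_index_def by blast
    with radsmall[OF e]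
    show "eventually (\<lambda>p. (SUP q\<in>{q\<in>J. S p q}. d (fst p) (fst q)) < e) (net_filter J S)"
    proof eventually_elim
      case (elim p)
      have "(SUP q\<in>{q\<in>J. S p q}. d (fst p) (fst q)) \<le> ennreal (snd p)"
      proof (rule SUP_least)
        fix q assume "q \<in> {q\<in>J. S p q}"
        then show "d (fst p) (fst q) \<le> ennreal (snd p)"
          using rad(2)[OF elim(2), of q] by simp
      qed
      then show ?case using elim(1) by (rule le_less_trans)
    qed
  qed auto
  have fX: "fst ` J \<subseteq> X" using JX by auto
  have ev: "eventually (\<lambda>i. P (x i)) (net_filter I R)"
    if ev: "eventually (\<lambda>p. P (fst p)) (net_filter J S)" for P
  proof -
    obtain p where p: "p \<in> J" "\<And>q. q \<in> J \<Longrightarrow> S p q \<Longrightarrow> P (fst q)"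
      using ev unfolding eventually_net_filter[OF NJ] by blast
    then obtain i t where i: "i \<in> I" "w i < ennreal t" "p = (x i, t)" by (auto simp: J_def)
    obtain e where e: "e > 0" "\<forall>u v. u \<le> w i \<longrightarrow> v \<le> ennreal e \<longrightarrow> u + v < ennreal t"
      using gap[OF i(2)] by blast
    obtain k where k: "k \<in> I" "\<And>j. j \<in> I \<Longrightarrow> R k j \<Longrightarrow> w j < ennreal e"
      using small[of "ennreal e"] e by auto
    obtain m where m: "m \<in> I" "R i m" "R k m" using up2 i k by blast
    have "P (x j)" if j: "j \<in> I" "R m j" for j
    proof -
      have "R i j" "R k j" using Rtr[OF m(2) j(2) i(1) m(1) j(1)] Rtr[OF m(3) j(2) k(1) m(1) j(1)] by simp_all
      then have "S p (x j, e)" unfolding i by (intro step[OF i(1) j(1) _ _ e(2)]) auto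
      moreover have "(x j, e) \<in> J" using k(2)[OF j(1) \<open>R k j\<close>] j(1) by (auto simp: J_def)
      ultimately show ?thesis using p(2)[of "(x j, e)"] by simp
    qed
    then show ?thesis using m(1) unfolding eventually_net_filter[OF N] by blast
  qed
  have lims: "((\<lambda>p. d c (fst p)) \<longlongrightarrow> L) (net_filter J S) \<longleftrightarrow>
      ((\<lambda>i. d c (x i)) \<longlongrightarrow> L) (net_filter I R)" if c: "c \<in> X" for c L
  proof
    assume "((\<lambda>p. d c (fst p)) \<longlongrightarrow> L) (net_filter J S)"
    then show "((\<lambda>i. d c (x i)) \<longlongrightarrow> L) (net_filter I R)"
      by (auto simp: order_tendsto_iff intro: ev)
  next
    assume T: "((\<lambda>i. d c (x i)) \<longlongrightarrow> L) (net_filter I R)"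
    show "((\<lambda>p. d c (fst p)) \<longlongrightarrow> L) (net_filter J S)"
    proof (rule order_tendstoI)
      fix a assume a: "a < L"
      then obtain b where b: "a < b" "b < L" using dense by blast
      have "b - a > 0" using b(1) by (simp add: diff_gr0_ennreal order_less_imp_not_less top.not_eq_extremum)
      have "eventually (\<lambda>p. p \<in> J) (net_filter J S)"
        using NJ unfolding eventually_net_filter[OF NJ] net_index_def by blast
      with radsmall[OF \<open>b - a > 0\<close>]
      show "eventually (\<lambda>p. a < d c (fst p)) (net_filter J S)"
      proof eventually_elim
        case (elim p)
        then obtain i t where i: "i \<in> I" "w i < ennreal t" "p = (x i, t)" by (auto simp: J_def)
        obtain k where k: "k \<in> I" "\<And>j. j \<in> I \<Longrightarrow> R k j \<Longrightarrow> b < d c (x j)"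
          using order_tendstoD(1)[OF T b(2)] unfolding eventually_net_filter[OF N] by blast
        obtain m where m: "m \<in> I" "R i m" "R k m" using up2 i k by blast
        have "b < d c (x m)" using k m by blast
        also have "\<dots> \<le> d c (x i) + d (x i) (x m)" using tri[OF c xX[OF i(1)] xX[OF m(1)]] .
        also have "\<dots> \<le> d c (x i) + w i" using wle[OF i(1) m(1,2)] by (rule add_left_mono)
        also have "\<dots> \<le> d c (x i) + (b - a)"
          using i elim by (intro add_left_mono) auto
        finally have lt: "b < d c (x i) + (b - a)" .
        show ?case
        proof (rule ccontr)
          assume "\<not> a < d c (fst p)"
          then have "d c (x i) + (b - a) \<le> a + (b - a)" using i by (intro add_right_mono) auto
          also have "\<dots> = b" using b(1) by (simp add: diff_add_cancel_ennreal add.commute)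
          finally show False using lt by simp
        qed
      qed
    next
      fix a assume a: "L < a"
      then obtain b where b: "L < b" "b < a" using dense by blast
      have "a - b > 0" using b(2) by (simp add: diff_gr0_ennreal order_less_imp_not_less top.not_eq_extremum)
      obtain i t where i: "i \<in> I" "d c (x i) < b" "ennreal t \<le> a - b" "(x i, t) \<in> J"
        using tail[OF \<open>a - b > 0\<close> order_tendstoD(2)[OF T b(1)]] by blast
      have "d c (fst q) < a" if q: "q \<in> J" "S (x i, t) q" for q
      proof -
        have dq: "d (x i) (fst q) < ennreal t" using rad(2)[OF i(4) q] by simp
        have "d c (fst q) \<le> d c (x i) + d (x i) (fst q)" using tri[OF c xX[OF i(1)] JX[OF q(1)]] .
        also have "\<dots> < b + ennreal t" by (rule add_strict_mono[OF i(2) dq])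
        also have "\<dots> \<le> b + (a - b)" using i by (intro add_left_mono) auto
        also have "\<dots> = a" using b(2) by (simp add: diff_add_cancel_ennreal add.commute)
        finally show ?thesis .
      qed
      then show "eventually (\<lambda>p. d c (fst p) < a) (net_filter J S)"
        using i(4) unfolding eventually_net_filter[OF NJ] by blast
    qed
  qed
  show thesis
  proof (rule that[OF NJ _ CJ])
    show "fst ` J \<subseteq> x ` I" by (auto simp: J_def)
    show "smyth_limit X d J S fst l \<longleftrightarrow> smyth_limit X d I R x l" for l
      unfolding smyth_limit_iff[OF fX NJ] smyth_limit_iff[OF x N] using lims by auto
  qed
qed

lemma smyth_complete_any_index:
  fixes I :: "'i set"
  assumes "distance_on X d" "smyth_complete X d"
    "net_index I R" "x ` I \<subseteq> X" "cauchy_net d I R x"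
  shows "\<exists>l\<in>X. smyth_limit X d I R x l"
proof (rule cauchy_net_reindex[OF assms(1,3-5)])
  fix J :: "('a \<times> real) set" and S y
  assume J: "net_index J S" "y ` J \<subseteq> x ` I" "cauchy_net d J S y"
    and eq: "\<And>l. smyth_limit X d J S y l \<longleftrightarrow> smyth_limit X d I R x l"
  have "y ` J \<subseteq> X" using J(2) assms(4) by (rule subset_trans)
  then have "\<exists>l\<in>X. smyth_limit X d J S y l"
    using assms(2) J(1,3) unfolding smyth_complete_def by blast
  then show ?thesis unfolding eq .
qed

lemma smyth_basis_any_index:
  fixes I :: "'a \<Rightarrow> 'i set"
  assumes d: "distance_on X d" and B: "B \<subseteq> X"
    and lim: "\<And>l. l \<in> X \<Longrightarrow> net_index (I l) (R l) \<and> x l ` I l \<subseteq> B \<and>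
      cauchy_net d (I l) (R l) (x l) \<and> smyth_limit X d (I l) (R l) (x l) l"
  shows "smyth_basis B X d"
  unfolding smyth_basis_def
proof (intro conjI ballI)
  show "B \<subseteq> X" by fact
  fix l assume l: "l \<in> X"
  have xB: "x l ` I l \<subseteq> B" using lim[OF l] by simp
  have xX: "x l ` I l \<subseteq> X" using xB B by (rule subset_trans)
  have N: "net_index (I l) (R l)" and C: "cauchy_net d (I l) (R l) (x l)"
    using lim[OF l] by simp_all
  show "\<exists>(I :: ('a \<times> real) set) R x. net_index I R \<and> x ` I \<subseteq> B \<and> cauchy_net d I R x \<and>
      smyth_limit X d I R x l"
  proof (rule cauchy_net_reindex[OF d N xX C])
    fix J :: "('a \<times> real) set" and S y
    assume J: "net_index J S" "y ` J \<subseteq> x l ` I l" "cauchy_net d J S y"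
      and eq: "\<And>m. smyth_limit X d J S y m \<longleftrightarrow> smyth_limit X d (I l) (R l) (x l) m"
    have "y ` J \<subseteq> B" using J(2) xB by (rule subset_trans)
    moreover have "smyth_limit X d J S y l" unfolding eq using lim[OF l] by simp
    ultimately show ?thesis using J(1,3) by blast
  qed
qed

end

theory Submission
  imports Defs
begin

text \<open>
  A directed set \<open>Y\<close> of formal balls with radii tending to zero stands for the ideal limit of the
  centres of its balls: the number \<open>point_dist d c Y\<close>, the infimum of \<open>d c z + s\<close> over the balls
  \<open>(z, s)\<close> in \<open>Y\<close>, is the distance which that limit ought to have from a point \<open>c\<close>.  A point \<open>x\<close>
  itself is represented by \<open>{(x, 0)}\<close>, and this embedding of \<open>X\<close> in \<open>P0 X d\<close> preserves distances for
  the lower distance, which is always a hemimetric.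

  Everything hinges on one consequence of being Noetherian, \<open>P0_almost_greatest_ball\<close>: every such \<open>Y\<close>
  has, for each \<open>e > 0\<close>, a ball of radius at most \<open>e\<close> that bounds all of \<open>Y\<close> up to \<open>e\<close>.  Without it
  one could run through \<open>Y\<close> along a Cauchy sequence while forever meeting balls that are not
  bounded, and this sequence could not be Cauchy backwards.  The upper distance from \<open>Y\<close> to itself is
  therefore \<open>0\<close>.  Moreover the centre of the bounding ball is close to \<open>Y\<close> in both directions, so that
  \<open>X\<close> is symmetrically dense in \<open>P0 X d\<close>.  A Cauchy net in \<open>P0 X d\<close> has a natural candidate for its
  limit, defined by the distances of points to the net; symmetric density extends the convergence of
  the distances from points to the distances from all directed sets (\<open>smyth_complete_P0\<close>).  The same
  density makes \<open>X\<close> a basis, so that \<open>P0 X d\<close>, with \<open>X\<close> adjoined, is a hemimetric Smyth completion.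

  Conversely, a Smyth limit \<open>l\<close> in a hemimetric space can be tested against itself: the distances
  from \<open>l\<close> to the net tend to \<open>0\<close>, and those from the net to \<open>l\<close> do so because the net is Cauchy.
  Hence a space that embeds isometrically in a Smyth complete hemimetric space is Noetherian
  (\<open>noetherian_if_isometry_into_smyth_complete\<close>), which covers both \<open>P0 X d\<close> and arbitrary hemimetric
  completions.  If instead the upper distance is known to vanish on the diagonal, the Noetherian
  property results from an almost greatest element of the set of balls around members of a given
  Cauchy sequence (\<open>noetherian_if_upper_reflexive\<close>).
\<close>

section \<open>Nets and sequences\<close>

lemma net_index_nat: "net_index (UNIV :: nat set) (<)"
  unfolding net_index_def
proof (intro conjI ballI)
  show "\<exists>k\<in>UNIV. i < k \<and> j < k" for i j :: nat
    by (intro bexI[of _ "Suc (max i j)"]) auto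
qed (auto intro: transp_onI)

lemma net_index_eventually_mem: "net_index I R \<Longrightarrow> eventually (\<lambda>i. i \<in> I) (net_filter I R)"
  by (auto simp: eventually_net_filter net_index_def)

lemma net_filter_ne_bot: "net_index I R \<Longrightarrow> net_filter I R \<noteq> bot"
  unfolding trivial_limit_def eventually_net_filter by (simp add: net_index_def) blast

lemma eventually_net_filter_nat:
  "eventually P (net_filter UNIV (<)) \<longleftrightarrow> (\<exists>N::nat. \<forall>n>N. P n)"
  by (simp add: eventually_net_filter[OF net_index_nat])

lemma ennreal_less_gap:
  fixes a b :: ennreal
  assumes "a < b"
  obtains e :: real where "e > 0" "a + ennreal e < b"
proof -
  obtain c where c: "a < c" "c < b" using dense[OF assms] by blast
  obtain r where r: "a = ennreal r" "0 \<le> r" using c(1) by (cases a) auto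
  obtain s where s: "c = ennreal s" "0 \<le> s" using c(2) by (cases c) auto
  have "r < s" using c(1) r s by (simp add: ennreal_less_iff)
  moreover have "a + ennreal (s - r) = c" using r s \<open>r < s\<close> by (simp flip: ennreal_plus)
  ultimately show thesis using that[of "s - r"] c(2) by simp
qed

lemma cauchy_net_iff:
  assumes N: "net_index I R"
  shows "cauchy_net d I R x \<longleftrightarrow>
    (\<forall>e>0. \<exists>i\<in>I. \<forall>j\<in>I. R i j \<longrightarrow> (\<forall>k\<in>I. R j k \<longrightarrow> d (x j) (x k) \<le> ennreal e))"
    (is "_ \<longleftrightarrow> ?C")
proof
  assume C: "cauchy_net d I R x"
  show ?C
  proof (intro allI impI)
    fix e :: real assume "e > 0"
    then have "eventually (\<lambda>i. (SUP j\<in>{j\<in>I. R i j}. d (x i) (x j)) < ennreal e) (net_filter I R)"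
      using C unfolding cauchy_net_def by (intro order_tendstoD) auto
    then obtain i where "i \<in> I"
      and i: "\<And>j. j \<in> I \<Longrightarrow> R i j \<Longrightarrow> (SUP k\<in>{k\<in>I. R j k}. d (x j) (x k)) < ennreal e"
      unfolding eventually_net_filter[OF N] by blast
    have "d (x j) (x k) \<le> ennreal e" if "j \<in> I" "R i j" "k \<in> I" "R j k" for j k
      using i[OF that(1,2)] that by (intro order.trans[OF SUP_upper[of k] less_imp_le]) auto
    with \<open>i \<in> I\<close>
    show "\<exists>i\<in>I. \<forall>j\<in>I. R i j \<longrightarrow> (\<forall>k\<in>I. R j k \<longrightarrow> d (x j) (x k) \<le> ennreal e)"
      by blast
  qed
next
  assume C: ?C
  show "cauchy_net d I R x"
    unfolding cauchy_net_def
  proof (rule order_tendstoI)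
    fix a :: ennreal assume "0 < a"
    then obtain e where "e > 0" and e: "0 + ennreal e < a" by (rule ennreal_less_gap)
    with C obtain i where "i \<in> I"
      and i: "\<forall>j\<in>I. R i j \<longrightarrow> (\<forall>k\<in>I. R j k \<longrightarrow> d (x j) (x k) \<le> ennreal e)"
      by blast
    have "(SUP k\<in>{k\<in>I. R j k}. d (x j) (x k)) < a" if "j \<in> I" "R i j" for j
      using i that e by (intro le_less_trans[OF SUP_least e]) auto
    with \<open>i \<in> I\<close>
    show "eventually (\<lambda>j. (SUP k\<in>{k\<in>I. R j k}. d (x j) (x k)) < a) (net_filter I R)"
      unfolding eventually_net_filter[OF N] by blast
  qed auto
qed

lemma cauchy_sequence_iff:
  "cauchy_net d UNIV (<) x \<longleftrightarrow>
    (\<forall>e>0. \<exists>N::nat. \<forall>m>N. \<forall>n>m. d (x m) (x n) \<le> ennreal e)"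
  by (simp add: cauchy_net_iff[OF net_index_nat])

text \<open>
  The criterion holds for \<open>L = \<infinity>\<close> as well, but is then stronger than convergence: it forces \<open>f\<close> to
  be eventually infinite.  The distances from a fixed point to a Cauchy net behave in this way, for
  they exceed earlier ones by arbitrarily little; this is why the criterion suffices below.
\<close>
lemma tendsto_ennreal_if_eventually_close:
  fixes f :: "'i \<Rightarrow> ennreal"
  assumes "\<And>e::real. e > 0 \<Longrightarrow> eventually (\<lambda>i. f i \<le> L + ennreal e) F"
    and "\<And>e::real. e > 0 \<Longrightarrow> eventually (\<lambda>i. L \<le> f i + ennreal e) F"
  shows "(f \<longlongrightarrow> L) F"
proof (rule order_tendstoI)
  fix a assume "a < L"
  then obtain e where e: "e > 0" "a + ennreal e < L" by (rule ennreal_less_gap)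
  from assms(2)[OF e(1)] show "eventually (\<lambda>i. a < f i) F"
  proof (rule eventually_mono, intro leI notI[THEN not_le[THEN iffD1]])
    fix i assume "L \<le> f i + ennreal e" "f i \<le> a"
    then have "L \<le> a + ennreal e" using add_right_mono order_trans by blast
    then show False using e(2) by simp
  qed
next
  fix a assume "L < a"
  then obtain e where e: "e > 0" "L + ennreal e < a" by (rule ennreal_less_gap)
  from assms(1)[OF e(1)] show "eventually (\<lambda>i. f i < a) F"
    by (rule eventually_mono) (rule le_less_trans[OF _ e(2)])
qed

section \<open>Completeness and bases of hemimetric spaces\<close>

lemma distance_on_triangle:
  "distance_on X d \<Longrightarrow> x \<in> X \<Longrightarrow> y \<in> X \<Longrightarrow> z \<in> X \<Longrightarrow> d x z \<le> d x y + d y z"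
  by (auto simp: distance_on_def)

text \<open>
  Testing the Smyth limit \<open>l\<close> of an embedded Cauchy sequence against \<open>l\<close> itself gives
  \<open>d' l (e (x n)) \<longlonglongrightarrow> d' l l = 0\<close>, and testing it against the members of the sequence
  gives \<open>d' (e (x n)) l \<longlonglongrightarrow> 0\<close>.  So the sequence converges symmetrically, and is Cauchy in
  both directions.
\<close>
lemma noetherian_if_isometry_into_smyth_complete:
  fixes X :: "'a set" and X' :: "'b set"
  assumes h: "hemimetric_on X' d'" and c: "smyth_complete X' d'"
    and e: "e ` X \<subseteq> X'" and iso: "\<And>x y. x \<in> X \<Longrightarrow> y \<in> X \<Longrightarrow> d' (e x) (e y) = d x y"
  shows "noetherian X d"
  unfolding noetherian_def
proof (intro allI impI, elim conjE)
  fix x :: "nat \<Rightarrow> 'a" assume x: "range x \<subseteq> X" and C: "cauchy_net d UNIV (<) x"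
  have d': "distance_on X' d'" and refl: "\<And>l. l \<in> X' \<Longrightarrow> d' l l = 0"
    using h by (auto simp: hemimetric_on_def)
  define y where "y n = e (x n)" for n
  have xX: "x n \<in> X" for n using x by auto
  have yX: "y n \<in> X'" for n using xX[of n] e by (auto simp: y_def)
  have dy: "d' (y m) (y n) = d (x m) (x n)" for m n by (simp add: y_def iso xX)
  have "cauchy_net d' UNIV (<) y" using C by (simp add: cauchy_net_def dy)
  then obtain l where l: "l \<in> X'" and "smyth_limit X' d' UNIV (<) y l"
    using smyth_complete_any_index[OF d' c net_index_nat, of y] yX by blast
  then have lim: "((\<lambda>n. d' c (y n)) \<longlongrightarrow> d' c l) (net_filter UNIV (<))" if "c \<in> X'" for c
    using that yX smyth_limit_iff[OF _ net_index_nat, of y X' d' l] by blast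
  show "cauchy_net (op_dist d) UNIV (<) x"
    unfolding cauchy_sequence_iff op_dist_def
  proof (intro allI impI)
    fix e :: real assume e: "e > 0"
    obtain N where N: "\<And>m n. N < m \<Longrightarrow> m < n \<Longrightarrow> d (x m) (x n) \<le> ennreal (e/2)"
      using C e unfolding cauchy_sequence_iff by (meson half_gt_zero)
    have to: "d' (y m) l \<le> ennreal (e/2)" if "m > N" for m
    proof (rule tendsto_upperbound[OF lim[OF yX[of m]] _ net_filter_ne_bot[OF net_index_nat]])
      show "eventually (\<lambda>n. d' (y m) (y n) \<le> ennreal (e/2)) (net_filter UNIV (<))"
        unfolding eventually_net_filter_nat dy using N that by blast
    qed
    have "eventually (\<lambda>n. d' l (y n) < ennreal (e/2)) (net_filter UNIV (<))"
      using lim[OF l] e refl[OF l] by (intro order_tendstoD) auto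
    then obtain M where from_l: "\<And>n. M < n \<Longrightarrow> d' l (y n) < ennreal (e/2)"
      unfolding eventually_net_filter_nat by blast
    have "d (x n) (x m) \<le> ennreal e" if "max M N < m" "m < n" for m n
    proof -
      have "d (x n) (x m) \<le> d' (y n) l + d' l (y m)"
        unfolding dy[symmetric] by (intro distance_on_triangle[OF d'] yX l)
      also have "\<dots> \<le> ennreal (e/2) + ennreal (e/2)"
        using to[of n] from_l[of m] that by (intro add_mono) auto
      also have "\<dots> = ennreal e" using e by (simp flip: ennreal_plus)
      finally show ?thesis .
    qed
    then show "\<exists>N. \<forall>m>N. \<forall>n>m. d (x n) (x m) \<le> ennreal e" by blast
  qed
qed

text \<open>
  In a hemimetric space the domain axiom is automatic: the triangle inequality bounds the upper
  hemimetric by \<open>d\<close>, and the test point \<open>x\<close>, with \<open>d x x = 0\<close>, shows that the lower one is at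
  least \<open>d\<close>.
\<close>
lemma hemimetric_upper_le_lower:
  assumes "hemimetric_on X d" "x \<in> X" "y \<in> X"
  shows "upper_hemi X d x y \<le> lower_hemi X d x y"
proof -
  have "upper_hemi X d x y \<le> d x y"
    unfolding upper_hemi_def pos_diff_def using assms
    by (auto intro!: SUP_least Inf_lower simp: hemimetric_on_def distance_on_def add.commute)
  also have "d x y \<le> pos_diff (d x y) (d x x)"
    using assms by (auto simp: pos_diff_def hemimetric_on_def intro: Inf_greatest)
  also have "\<dots> \<le> lower_hemi X d x y"
    unfolding lower_hemi_def using assms by (intro SUP_upper)
  finally show ?thesis .
qed

text \<open>Symmetric density is enough, since symmetric convergence implies Smyth convergence.\<close>
lemma smyth_basis_if_symmetrically_dense:
  assumes d: "distance_on X d" and B: "B \<subseteq> X"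
    and dense: "\<And>l e. l \<in> X \<Longrightarrow> (e::real) > 0 \<Longrightarrow> \<exists>b\<in>B. d l b \<le> ennreal e \<and> d b l \<le> ennreal e"
  shows "smyth_basis B X d"
proof -
  define a where "a n = inverse (real (Suc n))" for n
  have "\<forall>l\<in>X. \<forall>n. \<exists>b\<in>B. d l b \<le> ennreal (a n) \<and> d b l \<le> ennreal (a n)"
    using dense by (simp add: a_def)
  then obtain x where x: "\<And>l n. l \<in> X \<Longrightarrow> x l n \<in> B \<and> d l (x l n) \<le> ennreal (a n) \<and>
      d (x l n) l \<le> ennreal (a n)"
    by (metis (lifting))
  have small: "\<exists>N. \<forall>n>N. ennreal (a n) \<le> ennreal e" if "e > 0" for e
  proof -
    obtain N where N: "a N < e" using reals_Archimedean[OF \<open>e > 0\<close>] by (auto simp: a_def)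
    have "a n \<le> a N" if "n > N" for n using that by (simp add: a_def field_simps)
    with N show ?thesis by (force intro!: exI[of _ N] ennreal_leI)
  qed
  show ?thesis
  proof (rule smyth_basis_any_index[OF d B, of "\<lambda>_. UNIV" "\<lambda>_. (<)" x], intro conjI)
    fix l assume l: "l \<in> X"
    have xB: "x l n \<in> B" "x l n \<in> X" for n using x l B by auto
    show "range (x l) \<subseteq> B" using xB by blast
    show "net_index (UNIV :: nat set) (<)" by (rule net_index_nat)
    show "cauchy_net d UNIV (<) (x l)"
      unfolding cauchy_sequence_iff
    proof (intro allI impI)
      fix e :: real assume e: "e > 0"
      then obtain N where N: "\<And>n. N < n \<Longrightarrow> ennreal (a n) \<le> ennreal (e/2)"
        using small[of "e/2"] by auto
      have "d (x l m) (x l n) \<le> ennreal e" if "N < m" "m < n" for m n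
      proof -
        have "d (x l m) (x l n) \<le> d (x l m) l + d l (x l n)"
          by (intro distance_on_triangle[OF d] xB l)
        also have "\<dots> \<le> ennreal (e/2) + ennreal (e/2)"
          using x[OF l, of m] x[OF l, of n] N[of m] N[of n] that by (intro add_mono) auto
        also have "\<dots> = ennreal e" using e by (simp flip: ennreal_plus)
        finally show ?thesis .
      qed
      then show "\<exists>N. \<forall>m>N. \<forall>n>m. d (x l m) (x l n) \<le> ennreal e" by blast
    qed
    have "((\<lambda>n. d c (x l n)) \<longlongrightarrow> d c l) (net_filter UNIV (<))" if c: "c \<in> X" for c
    proof (rule tendsto_ennreal_if_eventually_close)
      fix e :: real assume "e > 0"
      then obtain N where N: "\<And>n. N < n \<Longrightarrow> ennreal (a n) \<le> ennreal e"
        using small[of e] by auto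
      have "d c (x l n) \<le> d c l + ennreal e" if "n > N" for n
        using distance_on_triangle[OF d c l xB(2), of n] x[OF l, of n] N[OF that]
        by (meson add_left_mono order_trans)
      then show "eventually (\<lambda>n. d c (x l n) \<le> d c l + ennreal e) (net_filter UNIV (<))"
        unfolding eventually_net_filter_nat by blast
      have "d c l \<le> d c (x l n) + ennreal e" if "n > N" for n
        using distance_on_triangle[OF d c xB(2) l, of n] x[OF l, of n] N[OF that]
        by (meson add_left_mono order_trans)
      then show "eventually (\<lambda>n. d c l \<le> d c (x l n) + ennreal e) (net_filter UNIV (<))"
        unfolding eventually_net_filter_nat by blast
    qed
    then show "smyth_limit X d UNIV (<) (x l) l"
      using xB l by (subst smyth_limit_iff[OF _ net_index_nat]) auto
  qed
qed

lemma smyth_complete_pullback: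
  assumes D: "distance_on P D" and c: "smyth_complete P D" and g: "g ` X = P"
  shows "smyth_complete X (\<lambda>u v. D (g u) (g v))"
  unfolding smyth_complete_def
proof (intro allI impI, elim conjE)
  fix I :: "('b \<times> real) set" and R u
  assume N: "net_index I R" and u: "u ` I \<subseteq> X" and C: "cauchy_net (\<lambda>u v. D (g u) (g v)) I R u"
  have gu: "(g \<circ> u) ` I \<subseteq> P" using u g by auto
  have "cauchy_net D I R (g \<circ> u)" using C by (simp add: cauchy_net_def)
  then obtain z where "z \<in> P" and z: "smyth_limit P D I R (g \<circ> u) z"
    using smyth_complete_any_index[OF D c N gu] by blast
  then obtain l where l: "l \<in> X" "z = g l" using g by auto
  have "smyth_limit X (\<lambda>u v. D (g u) (g v)) I R u l"
    using z l g unfolding smyth_limit_iff[OF gu N] smyth_limit_iff[OF u N] by auto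
  with l show "\<exists>l\<in>X. smyth_limit X (\<lambda>u v. D (g u) (g v)) I R u l" by blast
qed

section \<open>Formal balls and the distance of a point to a set of them\<close>

lemma formal_balls_iff [simp]: "(x, r) \<in> formal_balls X \<longleftrightarrow> x \<in> X \<and> 0 \<le> r"
  by (auto simp: formal_balls_def)

lemma ball_dist_le_iff:
  "ball_dist d p q \<le> a \<longleftrightarrow> d (fst p) (fst q) + ennreal (snd q) \<le> ennreal (snd p) + a"
  by (cases p; cases q) (simp add: ball_dist_def ennreal_minus_le_iff)

lemma le_radius_plus_ball_dist:
  "d (fst p) (fst q) + ennreal (snd q) \<le> ennreal (snd p) + ball_dist d p q"
  unfolding ball_dist_le_iff[symmetric] by (rule order_refl)

lemma ball_dist_self: "d (fst p) (fst p) = 0 \<Longrightarrow> ball_dist d p p = 0"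
  by (cases p) (simp add: ball_dist_def)

lemma INF_ennreal_le_iff:
  fixes f :: "'b \<Rightarrow> ennreal"
  assumes "a \<noteq> top"
  shows "(INF y\<in>Y. f y) \<le> a \<longleftrightarrow> (\<forall>e>0. \<exists>y\<in>Y. f y \<le> a + ennreal e)"
proof
  assume L: "(INF y\<in>Y. f y) \<le> a"
  show "\<forall>e>0. \<exists>y\<in>Y. f y \<le> a + ennreal e"
  proof (intro allI impI)
    fix e :: real assume "e > 0"
    then have "a + 0 < a + ennreal e" using assms by (simp add: ennreal_add_left_cancel_less)
    then have "a < a + ennreal e" by (simp only: add_0_right)
    with L have "(INF y\<in>Y. f y) < a + ennreal e" by (rule le_less_trans)
    then obtain y where "y \<in> Y" "f y < a + ennreal e" unfolding INF_less_iff by blast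
    then show "\<exists>y\<in>Y. f y \<le> a + ennreal e" by (intro bexI[of _ y] less_imp_le)
  qed
next
  assume R: "\<forall>e>0. \<exists>y\<in>Y. f y \<le> a + ennreal e"
  show "(INF y\<in>Y. f y) \<le> a"
  proof (rule ennreal_le_epsilon)
    fix e :: real assume "e > 0"
    with R obtain y where y: "y \<in> Y" "f y \<le> a + ennreal e" by blast
    then show "(INF y\<in>Y. f y) \<le> a + ennreal e" by (rule INF_lower2)
  qed
qed

lemma INF_ennreal_approx:
  fixes f :: "'b \<Rightarrow> ennreal"
  assumes "a = (INF y\<in>Y. f y)" "a \<noteq> top" "e > 0"
  shows "\<exists>y\<in>Y. f y \<le> a + ennreal e"
proof -
  have "(INF y\<in>Y. f y) \<le> a" by (rule eq_refl[OF assms(1)[symmetric]])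
  with assms(3) show ?thesis unfolding INF_ennreal_le_iff[OF assms(2)] by blast
qed

lemma INF_ennreal_eq_0_iff:
  fixes f :: "'b \<Rightarrow> ennreal"
  shows "(INF y\<in>Y. f y) = 0 \<longleftrightarrow> (\<forall>e>0. \<exists>y\<in>Y. f y \<le> ennreal e)"
proof -
  have "(INF y\<in>Y. f y) = 0 \<longleftrightarrow> (INF y\<in>Y. f y) \<le> 0" by (rule le_zero_eq[symmetric])
  also have "\<dots> \<longleftrightarrow> (\<forall>e>0. \<exists>y\<in>Y. f y \<le> 0 + ennreal e)" by (rule INF_ennreal_le_iff) simp
  finally show ?thesis by (simp only: add_0_left)
qed

text \<open>
  A set \<open>Y\<close> in \<open>P0 X d\<close> stands for the ideal limit of the centres of its balls as the radii shrink;
  \<open>point_dist d c Y\<close> is what the distance from \<open>c\<close> to that limit has to be.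
\<close>
definition point_dist :: "('a \<Rightarrow> 'a \<Rightarrow> ennreal) \<Rightarrow> 'a \<Rightarrow> ('a \<times> real) set \<Rightarrow> ennreal" where
  "point_dist d c Y = (INF (z, s)\<in>Y. d c z + ennreal s)"

lemma point_dist_le: "(z, s) \<in> Y \<Longrightarrow> point_dist d c Y \<le> d c z + ennreal s"
  unfolding point_dist_def by (rule INF_lower2[of "(z, s)"]) simp_all

lemma point_dist_le_iff:
  assumes "a \<noteq> top"
  shows "point_dist d c Y \<le> a \<longleftrightarrow> (\<forall>e>0. \<exists>(z, s)\<in>Y. d c z + ennreal s \<le> a + ennreal e)"
  unfolding point_dist_def INF_ennreal_le_iff[OF assms] case_prod_unfold by (rule refl)

text \<open>
  Only the distances from points to \<open>Z\<close> enter the lower distance to \<open>Z\<close>, and there is no truncated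
  subtraction left to deal with.
\<close>
lemma lower_ball_dist_le_iff:
  "lower_ball_dist d Y Z \<le> a \<longleftrightarrow> (\<forall>(x, r)\<in>Y. point_dist d x Z \<le> ennreal r + a)"
proof (cases "a = top")
  case False
  have "(INF z\<in>Z. ball_dist d (x, r) z) \<le> a \<longleftrightarrow> point_dist d x Z \<le> ennreal r + a" for x r
  proof -
    have top: "ennreal r + a \<noteq> top" using False by simp
    show ?thesis
      unfolding INF_ennreal_le_iff[OF False] point_dist_le_iff[OF top] ball_dist_le_iff
      by (simp add: case_prod_unfold add.assoc)
  qed
  then show ?thesis unfolding lower_ball_dist_def by (auto simp: SUP_le_iff)
qed (simp add: case_prod_unfold)

lemma lower_ball_dist_singleton [simp]: "lower_ball_dist d {(x, 0)} Y = point_dist d x Y"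
  by (rule antisym) (auto simp: lower_ball_dist_le_iff intro: order_eq_refl
    lower_ball_dist_le_iff[of d "{(x, 0)}" Y "lower_ball_dist d {(x, 0)} Y", simplified])

lemma point_dist_singleton [simp]: "point_dist d x {(y, 0)} = d x y"
  by (simp add: point_dist_def)

lemma point_dist_le_lower_ball_dist:
  "(y, r) \<in> Y \<Longrightarrow> point_dist d y Z \<le> ennreal r + lower_ball_dist d Y Z"
  using lower_ball_dist_le_iff[of d Y Z "lower_ball_dist d Y Z"] by auto

lemma point_dist_triangle:
  assumes d: "distance_on X d" and "x \<in> X" "y \<in> X" "Z \<subseteq> formal_balls X"
  shows "point_dist d x Z \<le> d x y + point_dist d y Z"
proof (rule ennreal_le_epsilon)
  fix e :: real assume fin: "d x y + point_dist d y Z < top" and e: "e > 0"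
  then obtain z s where z: "(z, s) \<in> Z" "d y z + ennreal s \<le> point_dist d y Z + ennreal e"
    using point_dist_le_iff[of "point_dist d y Z" d y Z] by fastforce
  have "point_dist d x Z \<le> d x z + ennreal s" using z(1) by (rule point_dist_le)
  also have "d x z \<le> d x y + d y z" using z assms by (intro distance_on_triangle[OF d]) auto
  also have "d x y + d y z + ennreal s \<le> d x y + (point_dist d y Z + ennreal e)"
    using z(2) by (simp add: add.assoc add_left_mono)
  finally show "point_dist d x Z \<le> d x y + point_dist d y Z + ennreal e"
    by (simp add: add.assoc add_right_mono)
qed

lemma point_dist_triangle_set:
  assumes d: "distance_on X d" and "x \<in> X" "Y \<subseteq> formal_balls X" "Z \<subseteq> formal_balls X"
  shows "point_dist d x Z \<le> point_dist d x Y + lower_ball_dist d Y Z"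
proof (rule ennreal_le_epsilon)
  fix e :: real assume fin: "point_dist d x Y + lower_ball_dist d Y Z < top" and e: "e > 0"
  then obtain y r where y: "(y, r) \<in> Y" "d x y + ennreal r \<le> point_dist d x Y + ennreal e"
    using point_dist_le_iff[of "point_dist d x Y" d x Y] by fastforce
  have "point_dist d x Z \<le> d x y + point_dist d y Z"
    using y assms by (intro point_dist_triangle[OF d]) auto
  also have "\<dots> \<le> d x y + (ennreal r + lower_ball_dist d Y Z)"
    using y(1) by (intro add_left_mono point_dist_le_lower_ball_dist)
  also have "\<dots> \<le> (point_dist d x Y + ennreal e) + lower_ball_dist d Y Z"
    using y(2) by (simp add: add.assoc[symmetric] add_right_mono)
  finally show "point_dist d x Z \<le> point_dist d x Y + lower_ball_dist d Y Z + ennreal e"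
    by (simp add: ac_simps)
qed

lemma distance_on_lower_ball_dist:
  assumes d: "distance_on X d"
  shows "distance_on (Pow (formal_balls X)) (lower_ball_dist d)"
  unfolding distance_on_def
proof (intro ballI)
  fix Y Z W assume YZW: "Y \<in> Pow (formal_balls X)" "Z \<in> Pow (formal_balls X)" "W \<in> Pow (formal_balls X)"
  have "point_dist d y W \<le> ennreal r + (lower_ball_dist d Y Z + lower_ball_dist d Z W)"
    if "(y, r) \<in> Y" for y r
  proof -
    have "point_dist d y W \<le> point_dist d y Z + lower_ball_dist d Z W"
      using YZW that by (intro point_dist_triangle_set[OF d]) auto
    also have "\<dots> \<le> (ennreal r + lower_ball_dist d Y Z) + lower_ball_dist d Z W"
      using that by (intro add_right_mono point_dist_le_lower_ball_dist)
    finally show ?thesis by (simp add: add.assoc)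
  qed
  then show "lower_ball_dist d Y W \<le> lower_ball_dist d Y Z + lower_ball_dist d Z W"
    unfolding lower_ball_dist_le_iff by auto
qed

lemma distance_on_ball_dist:
  assumes d: "distance_on X d"
  shows "distance_on (formal_balls X) (ball_dist d)"
  unfolding distance_on_def
proof (intro ballI)
  fix p q w assume B: "p \<in> formal_balls X" "q \<in> formal_balls X" "w \<in> formal_balls X"
  have "d (fst p) (fst w) + ennreal (snd w) \<le>
      d (fst p) (fst q) + (d (fst q) (fst w) + ennreal (snd w))"
    using distance_on_triangle[OF d, of "fst p" "fst q" "fst w"] B
    by (auto simp: formal_balls_def add.assoc[symmetric] add_right_mono)
  also have "\<dots> \<le> d (fst p) (fst q) + (ennreal (snd q) + ball_dist d q w)"
    by (intro add_left_mono le_radius_plus_ball_dist)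
  also have "\<dots> \<le> (ennreal (snd p) + ball_dist d p q) + ball_dist d q w"
    unfolding add.assoc[symmetric] by (intro add_right_mono le_radius_plus_ball_dist)
  finally show "ball_dist d p w \<le> ball_dist d p q + ball_dist d q w"
    unfolding ball_dist_le_iff by (simp only: add.assoc)
qed

lemma distance_on_upper_ball_dist:
  assumes d: "distance_on X d"
  shows "distance_on (Pow (formal_balls X)) (upper_ball_dist d)"
  unfolding distance_on_def
proof (intro ballI)
  fix Y Z W assume YZW: "Y \<in> Pow (formal_balls X)" "Z \<in> Pow (formal_balls X)" "W \<in> Pow (formal_balls X)"
  show "upper_ball_dist d Y W \<le> upper_ball_dist d Y Z + upper_ball_dist d Z W" (is "_ \<le> ?a + ?b")
  proof (rule ennreal_le_epsilon)
    fix e :: real assume fin: "?a + ?b < top" and "e > 0"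
    have e: "e/2 > 0" using \<open>e > 0\<close> by simp
    have top: "?a \<noteq> top" "?b \<noteq> top" using fin by auto
    obtain z where z: "z \<in> Z" "(SUP y\<in>Y. ball_dist d y z) \<le> ?a + ennreal (e/2)"
      using INF_ennreal_approx[OF upper_ball_dist_def top(1) e] by blast
    obtain w where w: "w \<in> W" "(SUP z\<in>Z. ball_dist d z w) \<le> ?b + ennreal (e/2)"
      using INF_ennreal_approx[OF upper_ball_dist_def top(2) e] by blast
    have "ball_dist d y w \<le> ?a + ?b + ennreal e" if y: "y \<in> Y" for y
    proof -
      have "ball_dist d y w \<le> ball_dist d y z + ball_dist d z w"
        using y z w YZW by (intro distance_on_triangle[OF distance_on_ball_dist[OF d]]) auto
      also have "\<dots> \<le> (?a + ennreal (e/2)) + (?b + ennreal (e/2))"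
        using y z w by (intro add_mono) (auto simp: SUP_le_iff)
      also have "\<dots> = ?a + ?b + (ennreal (e/2) + ennreal (e/2))" by (simp only: ac_simps)
      also have "ennreal (e/2) + ennreal (e/2) = ennreal e"
        using e by (simp flip: ennreal_plus)
      finally show ?thesis .
    qed
    then have "(SUP y\<in>Y. ball_dist d y w) \<le> ?a + ?b + ennreal e" by (rule SUP_least)
    then show "upper_ball_dist d Y W \<le> ?a + ?b + ennreal e"
      unfolding upper_ball_dist_def using w(1) by (intro INF_lower2[of w]) auto
  qed
qed

section \<open>The space of directed sets of formal balls\<close>

text \<open>
  The two defining conditions of \<open>P0 X d\<close> merge into one: adding a ball of small radius to \<open>F\<close>
  makes the radius of the bounding ball small, too.
\<close>
lemma P0_iff:
  "Y \<in> P0 X d \<longleftrightarrow> Y \<subseteq> formal_balls X \<and>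
    (\<forall>F e. finite F \<longrightarrow> F \<subseteq> Y \<longrightarrow> e > 0 \<longrightarrow>
      (\<exists>p\<in>Y. snd p \<le> e \<and> (\<forall>q\<in>F. ball_dist d q p \<le> ennreal e)))"
    (is "_ \<longleftrightarrow> _ \<and> ?R")
proof -
  have dir: "ball_directed d Y \<longleftrightarrow> (\<forall>F e. finite F \<longrightarrow> F \<subseteq> Y \<longrightarrow> e > 0 \<longrightarrow>
      (\<exists>p\<in>Y. \<forall>q\<in>F. ball_dist d q p \<le> ennreal e))"
    unfolding ball_directed_def INF_ennreal_eq_0_iff SUP_le_iff by blast
  have small: "(INF (x, r)\<in>Y. ennreal r) = 0 \<longleftrightarrow> (\<forall>e>0. \<exists>p\<in>Y. snd p \<le> e)"
    unfolding INF_ennreal_eq_0_iff case_prod_unfold by (auto simp: ennreal_le_iff)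
  have "ball_directed d Y \<and> (INF (x, r)\<in>Y. ennreal r) = 0 \<longleftrightarrow> ?R" if Y: "Y \<subseteq> formal_balls X"
  proof
    assume A: "ball_directed d Y \<and> (INF (x, r)\<in>Y. ennreal r) = 0"
    show ?R
    proof (intro allI impI)
      fix F e assume F: "finite F" "F \<subseteq> Y" and e: "(e::real) > 0"
      then have e2: "e/2 > 0" by simp
      then obtain q where q: "q \<in> Y" "snd q \<le> e/2"
        using A[THEN conjunct2, unfolded small] by blast
      have "finite (insert q F)" "insert q F \<subseteq> Y" using F q by auto
      then obtain p where p: "p \<in> Y" "\<forall>q\<in>insert q F. ball_dist d q p \<le> ennreal (e/2)"
        using A[THEN conjunct1, unfolded dir] e2 by blast
      have r: "0 \<le> snd q" using Y q by (auto simp: formal_balls_def)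
      have "ennreal (snd p) \<le> d (fst q) (fst p) + ennreal (snd p)" by simp
      also have "\<dots> \<le> ennreal (snd q) + ennreal (e/2)"
        using p(2) unfolding ball_dist_le_iff[symmetric] by simp
      also have "\<dots> \<le> ennreal e" using q(2) r e by (simp flip: ennreal_plus)
      finally have "snd p \<le> e" using e by (simp add: ennreal_le_iff)
      moreover have "ennreal (e/2) \<le> ennreal e" using e by (intro ennreal_leI) simp
      then have "\<forall>q\<in>F. ball_dist d q p \<le> ennreal e" using p(2) order_trans by blast
      ultimately show "\<exists>p\<in>Y. snd p \<le> e \<and> (\<forall>q\<in>F. ball_dist d q p \<le> ennreal e)"
        using p(1) by blast
    qed
  next
    assume R: ?R
    have "\<exists>p\<in>Y. snd p \<le> e" if "e > 0" for e
      using R[rule_format, of "{}" e] that by auto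
    moreover have "\<exists>p\<in>Y. \<forall>q\<in>F. ball_dist d q p \<le> ennreal e"
      if "finite F" "F \<subseteq> Y" "e > 0" for F e
      using R[rule_format, of F e] that by blast
    ultimately show "ball_directed d Y \<and> (INF (x, r)\<in>Y. ennreal r) = 0"
      unfolding dir small by (intro conjI allI impI)
  qed
  then show ?thesis unfolding P0_def mem_Collect_eq by (intro conj_cong refl)
qed

lemma P0_formal_balls: "Y \<in> P0 X d \<Longrightarrow> Y \<subseteq> formal_balls X"
  by (simp add: P0_iff)

lemma P0_ball_in:
  assumes "Y \<in> P0 X d" "p \<in> Y"
  shows "fst p \<in> X" "0 \<le> snd p" "p \<in> formal_balls X"
  using P0_formal_balls[OF assms(1)] assms(2) by (auto simp: formal_balls_def)

lemma P0_bound: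
  assumes "Y \<in> P0 X d" "finite F" "F \<subseteq> Y" "e > 0"
  shows "\<exists>p\<in>Y. snd p \<le> e \<and> (\<forall>q\<in>F. ball_dist d q p \<le> ennreal e)"
  using assms by (simp add: P0_iff)

lemma distance_on_subset: "distance_on X d \<Longrightarrow> Y \<subseteq> X \<Longrightarrow> distance_on Y d"
  by (auto simp: distance_on_def)

lemma distance_on_P0:
  assumes "distance_on X d"
  shows "distance_on (P0 X d) (lower_ball_dist d)" "distance_on (P0 X d) (upper_ball_dist d)"
  by (rule distance_on_subset[OF distance_on_lower_ball_dist[OF assms]]
      distance_on_subset[OF distance_on_upper_ball_dist[OF assms]], auto dest: P0_formal_balls)+

lemma P0_point_dist_le_radius:
  assumes Y: "Y \<in> P0 X d" and p: "p \<in> Y"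
  shows "point_dist d (fst p) Y \<le> ennreal (snd p)"
  unfolding point_dist_le_iff[OF ennreal_neq_top]
proof (intro allI impI)
  fix e :: real assume e: "e > 0"
  have "finite {p}" "{p} \<subseteq> Y" using p by auto
  then obtain q where q: "q \<in> Y" "ball_dist d p q \<le> ennreal e" using P0_bound[OF Y _ _ e] by blast
  then have "d (fst p) (fst q) + ennreal (snd q) \<le> ennreal (snd p) + ennreal e"
    unfolding ball_dist_le_iff by simp
  then show "\<exists>(z, s)\<in>Y. d (fst p) z + ennreal s \<le> ennreal (snd p) + ennreal e"
    using q(1) by (intro bexI[of _ q]) (simp_all add: case_prod_unfold)
qed

lemma hemimetric_on_P0_lower:
  assumes "distance_on X d"
  shows "hemimetric_on (P0 X d) (lower_ball_dist d)"
  unfolding hemimetric_on_def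
proof (intro conjI ballI)
  fix Y assume Y: "Y \<in> P0 X d"
  have "lower_ball_dist d Y Y \<le> 0"
    unfolding lower_ball_dist_le_iff add_0_right case_prod_unfold
    by (rule ballI) (rule P0_point_dist_le_radius[OF Y])
  then show "lower_ball_dist d Y Y = 0" by simp
qed (rule distance_on_P0(1)[OF assms])

lemma singleton_in_P0:
  assumes "hemimetric_on X d" "x \<in> X"
  shows "{(x, 0)} \<in> P0 X d"
  unfolding P0_iff
proof (intro conjI allI impI)
  show "{(x, 0)} \<subseteq> formal_balls X" using assms(2) by simp
  fix F :: "('a \<times> real) set" and e :: real assume F: "F \<subseteq> {(x, 0)}" and "e > 0"
  have "ball_dist d (x, 0) (x, 0) = 0"
    using assms by (intro ball_dist_self) (simp add: hemimetric_on_def)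
  then have "\<forall>q\<in>F. ball_dist d q (x, 0) \<le> ennreal e" using F by auto
  then show "\<exists>p\<in>{(x, 0)}. snd p \<le> e \<and> (\<forall>q\<in>F. ball_dist d q p \<le> ennreal e)"
    using \<open>e > 0\<close> by simp
qed

section \<open>Directed sets over a Noetherian space\<close>

text \<open>
  If no ball \<open>p\<close> of small radius bounded all of \<open>Y\<close> up to \<open>e\<close>, each such \<open>p\<close> would have a
  witness \<open>b p\<close> against it.  Directedness gives balls \<open>p n\<close> in \<open>Y\<close> with shrinking radii such that
  \<open>p (n + 1)\<close> almost bounds both \<open>p n\<close> and \<open>b (p n)\<close>.  Their centres form a Cauchy sequence; in a
  Noetherian space it is also Cauchy backwards, so that eventually \<open>p n\<close> almost bounds
  \<open>p (n + 1)\<close>, hence \<open>b (p n)\<close>, a contradiction.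
\<close>
lemma P0_almost_greatest_ball:
  assumes h: "hemimetric_on X d" and noeth: "noetherian X d"
    and Y: "Y \<in> P0 X d" and e: "e > 0"
  shows "\<exists>p\<in>Y. snd p \<le> e \<and> (\<forall>q\<in>Y. ball_dist d q p \<le> ennreal e)"
proof (rule ccontr)
  assume neg: "\<not> ?thesis"
  have d: "distance_on X d" and refl: "\<And>x. x \<in> X \<Longrightarrow> d x x = 0"
    using h by (auto simp: hemimetric_on_def)
  note ball_tri = distance_on_triangle[OF distance_on_ball_dist[OF d]]
  have "\<forall>p\<in>Y. \<exists>q. snd p \<le> e \<longrightarrow> q \<in> Y \<and> \<not> ball_dist d q p \<le> ennreal e"
    using neg by blast
  then obtain b where b: "\<forall>p\<in>Y. snd p \<le> e \<longrightarrow> b p \<in> Y \<and> \<not> ball_dist d (b p) p \<le> ennreal e"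
    unfolding bchoice_iff by blast
  define a where "a n = e * (1/2) ^ n" for n
  have a: "a n > 0" "a (Suc n) = a n / 2" "a n \<le> e" for n
    using e by (auto simp: a_def power_le_one)
  have "\<exists>p. \<forall>n. (p n \<in> Y \<and> snd (p n) \<le> a n) \<and>
      (ball_dist d (p n) (p (Suc n)) \<le> ennreal (a (Suc n)) \<and>
      ball_dist d (b (p n)) (p (Suc n)) \<le> ennreal (a (Suc n)))"
  proof (rule dependent_nat_choice)
    show "\<exists>p. p \<in> Y \<and> snd p \<le> a 0" using P0_bound[OF Y finite.emptyI empty_subsetI a(1)] by blast
    fix p n assume p: "p \<in> Y \<and> snd p \<le> a n"
    then have "snd p \<le> e" using a(3)[of n] by linarith
    then have "b p \<in> Y" using b p by blast
    then have "{p, b p} \<subseteq> Y" using p by blast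
    from P0_bound[OF Y _ this a(1)[of "Suc n"]]
    show "\<exists>q. (q \<in> Y \<and> snd q \<le> a (Suc n)) \<and> (ball_dist d p q \<le> ennreal (a (Suc n)) \<and>
      ball_dist d (b p) q \<le> ennreal (a (Suc n)))" by blast
  qed
  then obtain p where pY: "\<And>n. p n \<in> Y" and rad: "\<And>n. snd (p n) \<le> a n"
    and next_p: "\<And>n. ball_dist d (p n) (p (Suc n)) \<le> ennreal (a (Suc n))"
    and next_b: "\<And>n. ball_dist d (b (p n)) (p (Suc n)) \<le> ennreal (a (Suc n))" by blast
  have bY: "b (p n) \<in> Y" and bad: "\<not> ball_dist d (b (p n)) (p n) \<le> ennreal e" for n
  proof -
    have "snd (p n) \<le> e" using rad[of n] a(3)[of n] by linarith
    then show "b (p n) \<in> Y" "\<not> ball_dist d (b (p n)) (p n) \<le> ennreal e" using b pY[of n] by auto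
  qed
  note pX = P0_ball_in[OF Y pY] and bX = P0_ball_in[OF Y bY]
  \<comment> \<open>The tolerances \<open>a (n + 1) = a n - a (n + 1)\<close> telescope.\<close>
  have chain: "ball_dist d (p n) (p (n + k)) \<le> ennreal (a n - a (n + k))" for n k
  proof (induction k)
    case 0
    show ?case using ball_dist_self[of d "p n"] refl[OF pX(1)] by simp
  next
    case (Suc k)
    have dec: "a (n + k) \<le> a n"
      using e by (auto simp: a_def intro!: power_decreasing)
    have "ball_dist d (p n) (p (n + Suc k)) \<le>
        ball_dist d (p n) (p (n + k)) + ball_dist d (p (n + k)) (p (Suc (n + k)))"
      using ball_tri[OF pX(3) pX(3) pX(3)] by simp
    also have "\<dots> \<le> ennreal (a n - a (n + k)) + ennreal (a (Suc (n + k)))"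
      by (intro add_mono Suc.IH next_p)
    also have "\<dots> = ennreal (a n - a (n + k) + a (Suc (n + k)))"
      using dec a(1)[of "Suc (n + k)"] by (intro ennreal_plus[symmetric]) auto
    also have "a n - a (n + k) + a (Suc (n + k)) = a n - a (n + Suc k)"
      using a(2)[of "n + k"] by simp
    finally show ?case .
  qed
  have forward: "d (fst (p m)) (fst (p n)) \<le> ennreal (2 * a m)" if "m < n" for m n
  proof -
    from less_imp_le[OF that] obtain k where n: "n = m + k" using le_Suc_ex by blast
    have "d (fst (p m)) (fst (p n)) \<le> d (fst (p m)) (fst (p n)) + ennreal (snd (p n))" by simp
    also have "\<dots> \<le> ennreal (snd (p m)) + ennreal (a m - a n)"
      using chain[of m k] unfolding n ball_dist_le_iff .
    also have "\<dots> \<le> ennreal (a m) + ennreal (a m)"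
      using rad[of m] a(1)[of n] by (intro add_mono ennreal_leI) auto
    also have "\<dots> = ennreal (2 * a m)" using a(1)[of m] by (simp flip: ennreal_plus)
    finally show ?thesis .
  qed
  have "a \<longlonglongrightarrow> e * 0" unfolding a_def by (intro tendsto_mult tendsto_const LIMSEQ_power_zero) simp
  then have a0: "a \<longlonglongrightarrow> 0" by simp
  have small: "\<exists>N. \<forall>n>N. a n < t" if "t > 0" for t
  proof -
    from order_tendstoD(2)[OF a0 that] obtain N where "\<forall>n\<ge>N. a n < t"
      unfolding eventually_sequentially by blast
    then have "\<forall>n>N. a n < t" by simp
    then show ?thesis by blast
  qed
  have "cauchy_net d UNIV (<) (\<lambda>n. fst (p n))"
    unfolding cauchy_sequence_iff
  proof (intro allI impI)
    fix t :: real assume "t > 0"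
    then obtain N where N: "\<And>m. N < m \<Longrightarrow> a m < t / 2" using small[of "t / 2"] by auto
    have "d (fst (p m)) (fst (p n)) \<le> ennreal t" if "N < m" "m < n" for m n
    proof -
      have "ennreal (2 * a m) \<le> ennreal t" using N[OF that(1)] by (intro ennreal_leI) simp
      with forward[OF that(2)] show ?thesis by (rule order_trans)
    qed
    then show "\<exists>N. \<forall>m>N. \<forall>n>m. d (fst (p m)) (fst (p n)) \<le> ennreal t" by blast
  qed
  moreover have "range (\<lambda>n. fst (p n)) \<subseteq> X" using pX(1) by blast
  ultimately have "cauchy_net (op_dist d) UNIV (<) (\<lambda>n. fst (p n))"
    using noeth unfolding noetherian_def by blast
  moreover have "e/4 > 0" using e by simp
  ultimately obtain N where N: "\<And>m n. N < m \<Longrightarrow> m < n \<Longrightarrow> d (fst (p n)) (fst (p m)) \<le> ennreal (e/4)"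
    unfolding cauchy_sequence_iff op_dist_def by blast
  obtain M where M: "\<And>n. M < n \<Longrightarrow> a n < e/4" using small[of "e/4"] e by auto
  define n where "n = Suc (max N M)"
  have n: "N < n" "M < n" by (auto simp: n_def)
  have "ball_dist d (p (Suc n)) (p n) \<le> d (fst (p (Suc n))) (fst (p n)) + ennreal (snd (p n))"
    unfolding ball_dist_le_iff by simp
  also have "\<dots> \<le> ennreal (e/4) + ennreal (e/4)"
    using N[OF n(1), of "Suc n"] rad[of n] M[OF n(2)] by (intro add_mono ennreal_leI) auto
  also have "\<dots> = ennreal (e/2)" using e by (simp flip: ennreal_plus)
  finally have backward: "ball_dist d (p (Suc n)) (p n) \<le> ennreal (e/2)" .
  have "ball_dist d (b (p n)) (p n) \<le> ball_dist d (b (p n)) (p (Suc n)) + ball_dist d (p (Suc n)) (p n)"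
    by (rule ball_tri[OF bX(3) pX(3) pX(3)])
  also have "\<dots> \<le> ennreal (a (Suc n)) + ennreal (e/2)" by (intro add_mono next_b backward)
  also have "\<dots> \<le> ennreal (e/2) + ennreal (e/2)"
    using M[of "Suc n"] n e by (intro add_right_mono ennreal_leI) auto
  also have "\<dots> = ennreal e" using e by (simp flip: ennreal_plus)
  finally show False using bad by blast
qed

lemma hemimetric_on_P0_upper:
  assumes h: "hemimetric_on X d" and noeth: "noetherian X d"
  shows "hemimetric_on (P0 X d) (upper_ball_dist d)"
  unfolding hemimetric_on_def
proof (intro conjI ballI)
  show "distance_on (P0 X d) (upper_ball_dist d)"
    using h by (intro distance_on_P0(2)) (simp add: hemimetric_on_def)
  fix Y assume "Y \<in> P0 X d"
  from P0_almost_greatest_ball[OF h noeth this]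
  show "upper_ball_dist d Y Y = 0"
    unfolding upper_ball_dist_def INF_ennreal_eq_0_iff SUP_le_iff by blast
qed

text \<open>
  Over a Noetherian space every directed set of balls is thus the limit of points even in the
  symmetric sense.  This is what lets Smyth convergence in \<open>P0 X d\<close> be tested at the points of
  \<open>X\<close> alone, and what makes \<open>X\<close> a basis.
\<close>
lemma P0_points_symmetrically_dense:
  assumes h: "hemimetric_on X d" and noeth: "noetherian X d"
    and Y: "Y \<in> P0 X d" and e: "e > 0"
  shows "\<exists>x\<in>X. lower_ball_dist d Y {(x, 0)} \<le> ennreal e \<and> point_dist d x Y \<le> ennreal e"
proof -
  obtain p where p: "p \<in> Y" "snd p \<le> e" "\<And>q. q \<in> Y \<Longrightarrow> ball_dist d q p \<le> ennreal e"
    using P0_almost_greatest_ball[OF assms] by blast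
  have "d (fst q) (fst p) \<le> ennreal (snd q) + ennreal e" if "q \<in> Y" for q
  proof -
    have "d (fst q) (fst p) \<le> d (fst q) (fst p) + ennreal (snd p)" by simp
    also have "\<dots> \<le> ennreal (snd q) + ennreal e" using p(3)[OF that] unfolding ball_dist_le_iff .
    finally show ?thesis .
  qed
  then have "lower_ball_dist d Y {(fst p, 0)} \<le> ennreal e"
    unfolding lower_ball_dist_le_iff point_dist_singleton case_prod_unfold by (rule ballI)
  moreover have "point_dist d (fst p) Y \<le> ennreal (snd p)" by (rule P0_point_dist_le_radius[OF Y p(1)])
  then have "point_dist d (fst p) Y \<le> ennreal e" using ennreal_leI[OF p(2)] by (rule order_trans)
  ultimately show ?thesis using P0_ball_in(1)[OF Y p(1)] by blast
qed

text \<open>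
  The limit \<open>Z\<close> of a Cauchy net \<open>Y\<close> consists of the balls \<open>(z, s)\<close> for which the distance from \<open>z\<close>
  to the net is eventually at most \<open>s\<close>.  Because the net is Cauchy, its own balls belong to \<open>Z\<close> once
  slightly enlarged; this makes \<open>Z\<close> directed and the distances from late members of the net to \<open>Z\<close>
  small, so that the distance from any \<open>C\<close> to \<open>Z\<close> hardly exceeds the one to \<open>Y i\<close>.  The reverse
  estimate holds from points by the choice of \<open>Z\<close>, and carries over to any \<open>C\<close> by approximating \<open>C\<close> symmetrically by a point, which is
  where the Noetherian condition enters.
\<close>
lemma smyth_complete_P0:
  assumes h: "hemimetric_on X d" and noeth: "noetherian X d"
  shows "smyth_complete (P0 X d) (lower_ball_dist d)"
  unfolding smyth_complete_def
proof (intro allI impI, elim conjE)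
  fix I :: "(('a \<times> real) set \<times> real) set" and R Y
  assume N: "net_index I R" and YP: "Y ` I \<subseteq> P0 X d" and C: "cauchy_net (lower_ball_dist d) I R Y"
  let ?D = "lower_ball_dist d"
  have d: "distance_on X d" and refl: "\<And>x. x \<in> X \<Longrightarrow> d x x = 0"
    using h by (auto simp: hemimetric_on_def)
  have D: "distance_on (P0 X d) ?D" by (rule distance_on_P0(1)[OF d])
  have YI: "Y i \<in> P0 X d" if "i \<in> I" for i using YP that by auto
  note YB = P0_formal_balls[OF YI]
  have Rtr: "R i k" if "R i j" "R j k" "i \<in> I" "j \<in> I" "k \<in> I" for i j k
    using N that unfolding net_index_def transp_on_def by blast
  have ev: "\<exists>i\<in>I. (\<forall>k\<in>I. R i k \<longrightarrow> ?D (Y i) (Y k) \<le> ennreal e) \<and> P i"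
    if "e > 0" and P: "eventually P (net_filter I R)" for e P
  proof -
    obtain j where j: "j \<in> I" "\<forall>i\<in>I. R j i \<longrightarrow> (\<forall>k\<in>I. R i k \<longrightarrow> ?D (Y i) (Y k) \<le> ennreal e)"
      using C \<open>e > 0\<close> unfolding cauchy_net_iff[OF N] by blast
    obtain j' where j': "j' \<in> I" "\<forall>i\<in>I. R j' i \<longrightarrow> P i"
      using P unfolding eventually_net_filter[OF N] by blast
    obtain i where "i \<in> I" "R j i" "R j' i" using N j(1) j'(1) unfolding net_index_def by blast
    with j(2) j'(2) show ?thesis by blast
  qed
  define Z where "Z = {p \<in> formal_balls X.
    eventually (\<lambda>i. point_dist d (fst p) (Y i) \<le> ennreal (snd p)) (net_filter I R)}"
  have ZB: "Z \<subseteq> formal_balls X" by (auto simp: Z_def)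
  \<comment> \<open>Balls of the net enter the limit once enlarged by the distances to the rest of the net.\<close>
  have enlarge: "(fst p, snd p + e) \<in> Z"
    if i: "i \<in> I" "\<forall>k\<in>I. R i k \<longrightarrow> ?D (Y i) (Y k) \<le> ennreal e" "e > 0" "p \<in> Y i" for i p e
  proof -
    note p = P0_ball_in[OF YI[OF i(1)] i(4)]
    have "point_dist d (fst p) (Y k) \<le> ennreal (snd p + e)" if k: "k \<in> I" "R i k" for k
    proof -
      have "point_dist d (fst p) (Y k) \<le> ennreal (snd p) + ?D (Y i) (Y k)"
        using point_dist_le_lower_ball_dist[of "fst p" "snd p" "Y i" d "Y k"] \<open>p \<in> Y i\<close> by simp
      also have "\<dots> \<le> ennreal (snd p) + ennreal e"
        using i(2) k by (intro add_left_mono) blast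
      also have "\<dots> = ennreal (snd p + e)" using p \<open>e > 0\<close> by (simp add: ennreal_plus)
      finally show ?thesis .
    qed
    then have "eventually (\<lambda>k. point_dist d (fst p) (Y k) \<le> ennreal (snd p + e)) (net_filter I R)"
      unfolding eventually_net_filter[OF N] using i(1) by blast
    then show ?thesis using p(1,2) \<open>e > 0\<close> by (simp add: Z_def)
  qed
  have ZP: "Z \<in> P0 X d"
    unfolding P0_iff
  proof (intro conjI allI impI ZB)
    fix F :: "('a \<times> real) set" and e :: real
    assume F: "finite F" "F \<subseteq> Z" and e: "e > 0"
    then have e3: "e/3 > 0" by simp
    have "eventually (\<lambda>i. \<forall>q\<in>F. point_dist d (fst q) (Y i) \<le> ennreal (snd q)) (net_filter I R)"
      using F by (intro eventually_ball_finite) (auto simp: Z_def)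
    then obtain i where i: "i \<in> I" and C_i: "\<forall>k\<in>I. R i k \<longrightarrow> ?D (Y i) (Y k) \<le> ennreal (e/3)"
      and Fi: "\<forall>q\<in>F. point_dist d (fst q) (Y i) \<le> ennreal (snd q)"
      using ev[OF e3] by blast
    have "\<exists>y\<in>Y i. ball_dist d q y \<le> ennreal (e/3)" if "q \<in> F" for q
    proof -
      have "\<exists>(z, s)\<in>Y i. d (fst q) z + ennreal s \<le> ennreal (snd q) + ennreal (e/3)"
        using Fi that e3 unfolding point_dist_le_iff[OF ennreal_neq_top] by blast
      then show ?thesis unfolding ball_dist_le_iff case_prod_unfold .
    qed
    then obtain y where y: "\<And>q. q \<in> F \<Longrightarrow> y q \<in> Y i" "\<And>q. q \<in> F \<Longrightarrow> ball_dist d q (y q) \<le> ennreal (e/3)"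
      by metis
    have yF: "finite (y ` F)" "y ` F \<subseteq> Y i" using F(1) y(1) by auto
    obtain p where p: "p \<in> Y i" "snd p \<le> e/3" "\<forall>q\<in>y ` F. ball_dist d q p \<le> ennreal (e/3)"
      using P0_bound[OF YI[OF i] yF e3] by blast
    let ?p = "(fst p, snd p + e/3)"
    note pX = P0_ball_in[OF YI[OF i] p(1)]
    have Z: "?p \<in> Z" by (rule enlarge[OF i C_i e3 p(1)])
    have "ball_dist d q ?p \<le> ennreal e" if q: "q \<in> F" for q
    proof -
      have qX: "q \<in> formal_balls X" using q F(2) ZB by blast
      note yX = P0_ball_in(3)[OF YI[OF i] y(1)[OF q]]
      have "ball_dist d q p \<le> ball_dist d q (y q) + ball_dist d (y q) p"
        by (rule distance_on_triangle[OF distance_on_ball_dist[OF d] qX yX pX(3)])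
      also have "\<dots> \<le> ennreal (e/3) + ennreal (e/3)"
        by (rule add_mono[OF y(2)[OF q] p(3)[rule_format, OF imageI[OF q]]])
      finally have "d (fst q) (fst p) + ennreal (snd p) \<le> ennreal (snd q) + (ennreal (e/3) + ennreal (e/3))"
        unfolding ball_dist_le_iff .
      then have "(d (fst q) (fst p) + ennreal (snd p)) + ennreal (e/3)
          \<le> (ennreal (snd q) + (ennreal (e/3) + ennreal (e/3))) + ennreal (e/3)"
        by (rule add_right_mono)
      moreover have "ennreal (snd p) + ennreal (e/3) = ennreal (snd p + e/3)"
        using pX e by (simp add: ennreal_plus)
      moreover have "ennreal (e/3) + ennreal (e/3) + ennreal (e/3) = ennreal e"
        using e by (simp flip: ennreal_plus)
      ultimately show ?thesis unfolding ball_dist_le_iff by (simp add: add.assoc)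
    qed
    moreover have "snd ?p \<le> e" using p(2) e by simp
    ultimately show "\<exists>p\<in>Z. snd p \<le> e \<and> (\<forall>q\<in>F. ball_dist d q p \<le> ennreal e)"
      using Z by blast
  qed
  have to_Z: "?D (Y i) Z \<le> ennreal e"
    if "i \<in> I" "\<forall>k\<in>I. R i k \<longrightarrow> ?D (Y i) (Y k) \<le> ennreal e" "e > 0" for i e
    unfolding lower_ball_dist_le_iff case_prod_unfold
  proof
    fix p assume p: "p \<in> Y i"
    note pX = P0_ball_in[OF YI[OF that(1)] p]
    have "point_dist d (fst p) Z \<le> d (fst p) (fst p) + ennreal (snd p + e)"
      by (rule point_dist_le[OF enlarge[OF that p]])
    also have "\<dots> = ennreal (snd p) + ennreal e"
      using refl pX \<open>e > 0\<close> by (simp add: ennreal_plus)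
    finally show "point_dist d (fst p) Z \<le> ennreal (snd p) + ennreal e" .
  qed
  have point_to_net:
    "eventually (\<lambda>i. point_dist d x (Y i) \<le> point_dist d x Z + ennreal e) (net_filter I R)"
    if x: "x \<in> X" and e: "e > 0" for x e
  proof (cases "point_dist d x Z = top")
    case False
    then obtain z s where z: "(z, s) \<in> Z" "d x z + ennreal s \<le> point_dist d x Z + ennreal e"
      using point_dist_le_iff[OF False, of d x Z] e by blast
    have zX: "z \<in> X" and ev_z: "eventually (\<lambda>i. point_dist d z (Y i) \<le> ennreal s) (net_filter I R)"
      using z(1) by (auto simp: Z_def)
    from ev_z net_index_eventually_mem[OF N] show ?thesis
    proof eventually_elim
      case (elim i)
      have "point_dist d x (Y i) \<le> d x z + point_dist d z (Y i)"
        by (rule point_dist_triangle[OF d x zX YB[OF elim(2)]])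
      also have "\<dots> \<le> d x z + ennreal s" using elim(1) by (rule add_left_mono)
      finally show ?case using z(2) by (rule order_trans)
    qed
  qed (simp add: top_add)
  have "((\<lambda>i. ?D C (Y i)) \<longlongrightarrow> ?D C Z) (net_filter I R)" if C: "C \<in> P0 X d" for C
  proof (rule tendsto_ennreal_if_eventually_close)
    fix e :: real assume e: "e > 0"
    then have e3: "e/3 > 0" by simp
    obtain x where x: "x \<in> X" "?D C {(x, 0)} \<le> ennreal (e/3)" "point_dist d x C \<le> ennreal (e/3)"
      using P0_points_symmetrically_dense[OF h noeth C e3] by blast
    have xP: "{(x, 0)} \<in> P0 X d" by (rule singleton_in_P0[OF h x(1)])
    from point_to_net[OF x(1) e3] net_index_eventually_mem[OF N]
    show "eventually (\<lambda>i. ?D C (Y i) \<le> ?D C Z + ennreal e) (net_filter I R)"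
    proof eventually_elim
      case (elim i)
      have "?D C (Y i) \<le> ?D C {(x, 0)} + point_dist d x (Y i)"
        using distance_on_triangle[OF D C xP YI[OF elim(2)]] by simp
      also have "\<dots> \<le> ennreal (e/3) + (point_dist d x Z + ennreal (e/3))"
        using x(2) elim(1) by (rule add_mono)
      also have "\<dots> \<le> ennreal (e/3) + ((ennreal (e/3) + ?D C Z) + ennreal (e/3))"
      proof (intro add_left_mono add_right_mono)
        have "point_dist d x Z \<le> point_dist d x C + ?D C Z"
          by (rule point_dist_triangle_set[OF d x(1) P0_formal_balls[OF C] ZB])
        also have "\<dots> \<le> ennreal (e/3) + ?D C Z" using x(3) by (rule add_right_mono)
        finally show "point_dist d x Z \<le> ennreal (e/3) + ?D C Z" .
      qed
      also have "\<dots> = ?D C Z + (ennreal (e/3) + ennreal (e/3) + ennreal (e/3))" by (simp only: ac_simps)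
      also have "ennreal (e/3) + ennreal (e/3) + ennreal (e/3) = ennreal e"
        using e by (simp flip: ennreal_plus)
      finally show ?case .
    qed
  next
    fix e :: real assume e: "e > 0"
    obtain j where j: "j \<in> I" "\<forall>i\<in>I. R j i \<longrightarrow> (\<forall>k\<in>I. R i k \<longrightarrow> ?D (Y i) (Y k) \<le> ennreal e)"
      using \<open>cauchy_net ?D I R Y\<close> e unfolding cauchy_net_iff[OF N] by blast
    have "?D C Z \<le> ?D C (Y i) + ennreal e" if i: "i \<in> I" "R j i" for i
    proof -
      have "?D C Z \<le> ?D C (Y i) + ?D (Y i) Z" by (rule distance_on_triangle[OF D C YI[OF i(1)] ZP])
      also have "?D (Y i) Z \<le> ennreal e" using j(2) i e by (intro to_Z) auto
      finally show ?thesis by (simp add: add_left_mono)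
    qed
    then show "eventually (\<lambda>i. ?D C Z \<le> ?D C (Y i) + ennreal e) (net_filter I R)"
      unfolding eventually_net_filter[OF N] using j(1) by blast
  qed
  then have "smyth_limit (P0 X d) ?D I R Y Z" using ZP unfolding smyth_limit_iff[OF YP N] by blast
  with ZP show "\<exists>l\<in>P0 X d. smyth_limit (P0 X d) ?D I R Y l" by blast
qed

section \<open>The equivalence\<close>

text \<open>
  The balls around members of a Cauchy sequence which contain the later members form a
  directed set.  An element \<open>(x m, r)\<close> of it that almost bounds all others has a small radius \<open>r\<close>,
  and the distances \<open>d (x n) (x m)\<close> are small for late \<open>n\<close>.  Going from \<open>x k\<close> back to \<open>x j\<close> by way
  of \<open>x m\<close> is thus a short path for late \<open>j < k\<close>.
\<close>
lemma noetherian_if_upper_reflexive: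
  assumes h: "hemimetric_on X d" and up: "hemimetric_on (P0 X d) (upper_ball_dist d)"
  shows "noetherian X d"
  unfolding noetherian_def
proof (intro allI impI, elim conjE)
  fix x :: "nat \<Rightarrow> 'a" assume range: "range x \<subseteq> X" and C: "cauchy_net d UNIV (<) x"
  have d: "distance_on X d" using h by (simp add: hemimetric_on_def)
  have xX: "x n \<in> X" for n using range by auto
  define Y where "Y = {(x n, r) |n r. 0 \<le> r \<and> (\<forall>m>n. d (x n) (x m) \<le> ennreal r)}"
  have tail: "\<exists>N. \<forall>n>N. (x n, e) \<in> Y" if e: "e > 0" for e
  proof -
    obtain N where "\<forall>n>N. \<forall>m>n. d (x n) (x m) \<le> ennreal e"
      using C e unfolding cauchy_sequence_iff by blast
    then have "(x n, e) \<in> Y" if "n > N" for n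
      unfolding Y_def using that e by (blast intro: less_imp_le)
    then show ?thesis by blast
  qed
  have "Y \<in> P0 X d"
    unfolding P0_iff
  proof (intro conjI allI impI)
    show "Y \<subseteq> formal_balls X" using xX by (auto simp: Y_def)
    fix F e assume F: "finite F" "F \<subseteq> Y" and e: "(e::real) > 0"
    have "eventually (\<lambda>m. \<forall>q\<in>F. d (fst q) (x m) \<le> ennreal (snd q)) (net_filter UNIV (<))"
    proof (intro eventually_ball_finite F(1) ballI)
      fix q assume "q \<in> F"
      then obtain n r where "q = (x n, r)" "\<forall>m>n. d (x n) (x m) \<le> ennreal r"
        using F(2) by (auto simp: Y_def)
      then show "eventually (\<lambda>m. d (fst q) (x m) \<le> ennreal (snd q)) (net_filter UNIV (<))"
        unfolding eventually_net_filter_nat by auto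
    qed
    then obtain N where N: "\<And>m. m > N \<Longrightarrow> \<forall>q\<in>F. d (fst q) (x m) \<le> ennreal (snd q)"
      unfolding eventually_net_filter_nat by blast
    obtain M where M: "\<And>m. m > M \<Longrightarrow> (x m, e) \<in> Y" using tail[OF e] by blast
    define m where "m = Suc (max N M)"
    have m: "N < m" "M < m" by (auto simp: m_def)
    have "ball_dist d q (x m, e) \<le> ennreal e" if "q \<in> F" for q
      unfolding ball_dist_le_iff fst_conv snd_conv
      using N[OF m(1)] that by (intro add_right_mono) blast
    then show "\<exists>p\<in>Y. snd p \<le> e \<and> (\<forall>q\<in>F. ball_dist d q p \<le> ennreal e)"
      using M[OF m(2)] by (intro bexI[of _ "(x m, e)"]) auto
  qed
  then have "upper_ball_dist d Y Y = 0" using up by (simp add: hemimetric_on_def)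
  then have greatest: "\<exists>p\<in>Y. \<forall>q\<in>Y. ball_dist d q p \<le> ennreal e" if "e > 0" for e
    using that unfolding upper_ball_dist_def INF_ennreal_eq_0_iff SUP_le_iff by blast
  show "cauchy_net (op_dist d) UNIV (<) x"
    unfolding cauchy_sequence_iff op_dist_def
  proof (intro allI impI)
    fix e :: real assume e: "e > 0"
    then have e4: "e/4 > 0" by simp
    obtain p where "p \<in> Y" and p: "\<And>q. q \<in> Y \<Longrightarrow> ball_dist d q p \<le> ennreal (e/4)"
      using greatest[OF e4] by blast
    then obtain m r where mr: "p = (x m, r)" "0 \<le> r" "\<forall>n>m. d (x m) (x n) \<le> ennreal r"
      by (auto simp: Y_def)
    obtain N where N: "\<And>n. n > N \<Longrightarrow> (x n, e/4) \<in> Y" using tail[OF e4] by blast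
    have half: "d (x n) (x m) + ennreal r \<le> ennreal (e/2)" if "n > N" for n
    proof -
      have "d (x n) (x m) + ennreal r \<le> ennreal (e/4) + ennreal (e/4)"
        using p[OF N[OF that]] unfolding ball_dist_le_iff mr(1) fst_conv snd_conv .
      also have "\<dots> = ennreal (e/2)" using e by (simp flip: ennreal_plus)
      finally show ?thesis .
    qed
    have "d (x k) (x j) \<le> ennreal e" if "max N m < j" "j < k" for j k
    proof -
      have "d (x k) (x j) \<le> d (x k) (x m) + d (x m) (x j)"
        by (rule distance_on_triangle[OF d xX xX xX])
      also have "\<dots> \<le> ennreal (e/2) + ennreal (e/2)"
      proof (rule add_mono)
        have "d (x k) (x m) \<le> d (x k) (x m) + ennreal r" by simp
        also have "\<dots> \<le> ennreal (e/2)" using that by (intro half) simp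
        finally show "d (x k) (x m) \<le> ennreal (e/2)" .
        have "d (x m) (x j) \<le> ennreal r" using mr(3) that by simp
        also have "\<dots> \<le> d (x k) (x m) + ennreal r" by simp
        also have "\<dots> \<le> ennreal (e/2)" using that by (intro half) simp
        finally show "d (x m) (x j) \<le> ennreal (e/2)" .
      qed
      also have "\<dots> = ennreal e" using e by (simp flip: ennreal_plus)
      finally show ?thesis .
    qed
    then show "\<exists>N. \<forall>m>N. \<forall>n>m. d (x n) (x m) \<le> ennreal e" by blast
  qed
qed

text \<open>
  The completion adjoins \<open>P0 X d\<close> to \<open>X\<close>, each point \<open>x\<close> being at distance zero in both directions
  from \<open>{(x, 0)}\<close>.  All distances are computed in \<open>P0 X d\<close> by way of the map \<open>g\<close>, so that completeness
  and density are inherited from there.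
\<close>
lemma hemimetric_smyth_completion_exists:
  fixes X :: "'a set"
  assumes h: "hemimetric_on X d" and noeth: "noetherian X d"
  shows "\<exists>(e :: 'a \<Rightarrow> 'a + ('a \<times> real) set) X' d'. hemimetric_smyth_completion X d e X' d'"
proof -
  let ?D = "lower_ball_dist d"
  define g :: "'a + ('a \<times> real) set \<Rightarrow> ('a \<times> real) set" where "g = case_sum (\<lambda>x. {(x, 0)}) id"
  define X' where "X' = Inl ` X \<union> Inr ` P0 X d"
  define d' where "d' = (\<lambda>u v. ?D (g u) (g v))"
  have d: "distance_on X d" using h by (simp add: hemimetric_on_def)
  have hP: "hemimetric_on (P0 X d) ?D" by (rule hemimetric_on_P0_lower[OF d])
  have g: "g ` X' = P0 X d"
    using singleton_in_P0[OF h] by (auto simp: g_def X'_def image_Un image_image)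
  have gX: "g u \<in> P0 X d" if "u \<in> X'" for u using that g by blast
  have h': "hemimetric_on X' d'"
    unfolding hemimetric_on_def distance_on_def d'_def
  proof (intro conjI ballI)
    show "?D (g u) (g w) \<le> ?D (g u) (g v) + ?D (g v) (g w)" if "u \<in> X'" "v \<in> X'" "w \<in> X'" for u v w
      using that by (intro distance_on_triangle[OF distance_on_P0(1)[OF d]] gX)
    show "?D (g u) (g u) = 0" if "u \<in> X'" for u
      using hP gX[OF that] by (simp add: hemimetric_on_def)
  qed
  then have dist': "distance_on X' d'" by (simp add: hemimetric_on_def)
  have sub: "Inl ` X \<subseteq> X'" by (simp add: X'_def)
  have complete: "smyth_complete X' d'"
    unfolding d'_def
    by (rule smyth_complete_pullback[OF distance_on_P0(1)[OF d] smyth_complete_P0[OF h noeth] g])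
  have dense: "\<exists>v\<in>Inl ` X. d' u v \<le> ennreal e \<and> d' v u \<le> ennreal e"
    if u: "u \<in> X'" and e: "e > 0" for u e
  proof -
    obtain x where "x \<in> X" "?D (g u) {(x, 0)} \<le> ennreal e" "point_dist d x (g u) \<le> ennreal e"
      using P0_points_symmetrically_dense[OF h noeth gX[OF u] e] by blast
    then show ?thesis by (intro bexI[of _ "Inl x"]) (simp_all add: d'_def g_def)
  qed
  have basis: "smyth_basis (Inl ` X) X' d'"
    by (rule smyth_basis_if_symmetrically_dense[OF dist' sub dense])
  have basis_self: "smyth_basis X' X' d'"
  proof (rule smyth_basis_if_symmetrically_dense[OF dist' order_refl])
    fix l and e :: real assume "l \<in> X'" "e > 0"
    then show "\<exists>b\<in>X'. d' l b \<le> ennreal e \<and> d' b l \<le> ennreal e" using dense sub by blast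
  qed
  have "smyth_domain X' d'"
    unfolding smyth_domain_def
    using complete basis_self hemimetric_upper_le_lower[OF h'] by blast
  moreover have "d' (Inl x) (Inl y) = d x y" for x y by (simp add: d'_def g_def)
  ultimately have "hemimetric_smyth_completion X d Inl X' d'"
    unfolding hemimetric_smyth_completion_def smyth_completion_def
    using sub dist' basis h' by simp
  then show ?thesis by blast
qed

lemma noetherian_if_hemimetric_smyth_completion:
  assumes "hemimetric_smyth_completion X d e X' d'"
  shows "noetherian X d"
  using assms unfolding hemimetric_smyth_completion_def smyth_completion_def smyth_domain_def
  by (intro noetherian_if_isometry_into_smyth_complete[of X' d' e X d]) auto

theorem theorem6p3:
  fixes X :: "'a set" and d :: "'a \<Rightarrow> 'a \<Rightarrow> ennreal"
  assumes "hemimetric_on X d"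
  shows "(noetherian X d \<longleftrightarrow> smyth_complete (P0 X d) (lower_ball_dist d))
    \<and> (noetherian X d \<longleftrightarrow> hemimetric_on (P0 X d) (upper_ball_dist d))
    \<and> (noetherian X d \<longleftrightarrow>
         (\<exists>e (X' :: ('a + ('a \<times> real) set) set) d'. hemimetric_smyth_completion X d e X' d'))
    \<and> ((\<exists>e (X' :: 'b set) d'. hemimetric_smyth_completion X d e X' d') \<longrightarrow> noetherian X d)"
proof (intro conjI iffI impI)
  assume noeth: "noetherian X d"
  show "smyth_complete (P0 X d) (lower_ball_dist d)" by (rule smyth_complete_P0[OF assms noeth])
  show "hemimetric_on (P0 X d) (upper_ball_dist d)" by (rule hemimetric_on_P0_upper[OF assms noeth])
  show "\<exists>e (X' :: ('a + ('a \<times> real) set) set) d'. hemimetric_smyth_completion X d e X' d'"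
    by (rule hemimetric_smyth_completion_exists[OF assms noeth])
next
  assume c: "smyth_complete (P0 X d) (lower_ball_dist d)"
  have "distance_on X d" using assms by (simp add: hemimetric_on_def)
  then have "hemimetric_on (P0 X d) (lower_ball_dist d)" by (rule hemimetric_on_P0_lower)
  then show "noetherian X d"
  proof (rule noetherian_if_isometry_into_smyth_complete[OF _ c])
    show "(\<lambda>x. {(x, 0)}) ` X \<subseteq> P0 X d" using singleton_in_P0[OF assms] by blast
  qed simp
next
  assume "hemimetric_on (P0 X d) (upper_ball_dist d)"
  then show "noetherian X d" by (rule noetherian_if_upper_reflexive[OF assms])
next
  assume "\<exists>e (X' :: ('a + ('a \<times> real) set) set) d'. hemimetric_smyth_completion X d e X' d'"
  then show "noetherian X d" using noetherian_if_hemimetric_smyth_completion by blast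
next
  assume "\<exists>e (X' :: 'b set) d'. hemimetric_smyth_completion X d e X' d'"
  then show "noetherian X d" using noetherian_if_hemimetric_smyth_completion by blast
qed

end
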